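(* Let $U\subseteq\mathcal{P}(\omega)$ be a Turing ideal such that $\mathcal{U}=\{[A]:A\in U\}\subseteq\mathcal{S}$ is nonempty. Then $\mathcal{U}$ is closed in $(\mathcal{S},\delta)$ if and only if $U$ is jump-cofinal in the Turing degrees and every countable subset of $U$ has an upper bound (with respect to $\le_T$) in $U$.
   Context: For $A\subseteq\omega$ and $n\ge1$, $\rho_n(A)=|A\cap[0,n)|/n$, and $\overline{\rho}(A)=\limsup_n\rho_n(A)$. Sets $A,B$ are coarsely similar if $\lim_n \rho_n(A\bigtriangleup B)=0$; $[A]$ is the coarse similarity class of $A$, $\mathcal{S}$ the set of all classes, and $\delta([A],[B])=\overline{\rho}(A\bigtriangleup B)$ is a metric on $\mathcal{S}$. A Turing ideal is a subset of $\mathcal{P}(\omega)$ closed downward under $\le_T$ and closed under finite joins. A collection $U$ is jump-cofinal in the Turing degrees if for every $X\subseteq\omega$ there is $C\in U$ with $X\le_T C'$ (the Turing jump of $C$). *)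

theory Defs
  imports "HOL-Analysis.Analysis" "HOL-Library.Nat_Bijection" "HOL-Library.Countable_Set"
begin

section \<open>Asymptotic density and coarse similarity\<close>

definition density_upto :: "nat \<Rightarrow> nat set \<Rightarrow> real" where
  "density_upto n A = real (card (A \<inter> {0..<n})) / real n"

text \<open>
  \<^const>\<open>limsup\<close> needs a complete lattice, hence the detour through the extended reals.
  All densities lie in the unit interval, so \<^const>\<open>real_of_ereal\<close> loses nothing
  (see \<open>ereal_upper_density\<close> below).
\<close>

definition upper_density :: "nat set \<Rightarrow> real" where
  "upper_density A = real_of_ereal (limsup (\<lambda>n. ereal (density_upto n A)))"

definition coarsely_similar :: "nat set \<Rightarrow> nat set \<Rightarrow> bool" where
  "coarsely_similar A B \<longleftrightarrow> (\<lambda>n. density_upto n (sym_diff A B)) \<longlonglongrightarrow> 0"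

lemma density_upto_nonneg: "0 \<le> density_upto n A"
  by (simp add: density_upto_def)

lemma density_upto_le_1: "density_upto n A \<le> 1"
proof -
  have "card (A \<inter> {0..<n}) \<le> card {0..<n}"
    by (intro card_mono) auto
  then show ?thesis
    by (simp add: density_upto_def divide_le_eq)
qed

lemma density_upto_triangle:
  "density_upto n (sym_diff A C)
     \<le> density_upto n (sym_diff A B) + density_upto n (sym_diff B C)"
proof -
  have "card (sym_diff A C \<inter> {0..<n})
      \<le> card ((sym_diff A B \<inter> {0..<n}) \<union> (sym_diff B C \<inter> {0..<n}))"
    by (intro card_mono) auto
  also have "\<dots> \<le> card (sym_diff A B \<inter> {0..<n}) + card (sym_diff B C \<inter> {0..<n})"
    by (rule card_Un_le)
  finally show ?thesis
    by (simp add: density_upto_def flip: add_divide_distrib of_nat_add) (simp add: divide_right_mono)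
qed

lemma limsup_density_bounds:
  "0 \<le> limsup (\<lambda>n. ereal (density_upto n A))" "limsup (\<lambda>n. ereal (density_upto n A)) \<le> 1"
proof -
  show "0 \<le> limsup (\<lambda>n. ereal (density_upto n A))"
    by (intro le_Limsup always_eventually) (auto simp: density_upto_nonneg)
  show "limsup (\<lambda>n. ereal (density_upto n A)) \<le> 1"
    by (intro Limsup_bounded always_eventually) (auto simp: density_upto_le_1)
qed

lemma ereal_upper_density:
  "ereal (upper_density A) = limsup (\<lambda>n. ereal (density_upto n A))"
  using limsup_density_bounds[of A] unfolding upper_density_def
  by (cases "limsup (\<lambda>n. ereal (density_upto n A))") auto

lemma upper_density_nonneg: "0 \<le> upper_density A"
  using limsup_density_bounds(1)[of A] by (simp flip: ereal_upper_density)

lemma upper_density_triangle: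
  "upper_density (sym_diff A C) \<le> upper_density (sym_diff A B) + upper_density (sym_diff B C)"
proof -
  have "limsup (\<lambda>n. ereal (density_upto n (sym_diff A C)))
      \<le> limsup (\<lambda>n. ereal (density_upto n (sym_diff A B)) + ereal (density_upto n (sym_diff B C)))"
    by (intro Limsup_mono always_eventually) (simp add: density_upto_triangle)
  also have "\<dots> \<le> limsup (\<lambda>n. ereal (density_upto n (sym_diff A B)))
      + limsup (\<lambda>n. ereal (density_upto n (sym_diff B C)))"
    by (rule ereal_limsup_add_mono)
  finally show ?thesis
    by (simp flip: ereal_upper_density)
qed

lemma coarsely_similar_iff_upper_density:
  "coarsely_similar A B \<longleftrightarrow> upper_density (sym_diff A B) = 0"
proof
  let ?f = "\<lambda>n. ereal (density_upto n (sym_diff A B))"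
  assume "coarsely_similar A B"
  then have "?f \<longlonglongrightarrow> ereal 0"
    by (simp add: coarsely_similar_def)
  then have "limsup ?f = ereal 0"
    by (intro lim_imp_Limsup) auto
  then show "upper_density (sym_diff A B) = 0"
    by (simp add: upper_density_def)
next
  let ?f = "\<lambda>n. ereal (density_upto n (sym_diff A B))"
  assume "upper_density (sym_diff A B) = 0"
  then have 0: "limsup ?f = 0"
    by (metis ereal_upper_density zero_ereal_def)
  have "0 \<le> liminf ?f"
    by (intro Liminf_bounded always_eventually) (auto simp: density_upto_nonneg)
  moreover have "liminf ?f \<le> limsup ?f"
    by (intro Liminf_le_Limsup) auto
  ultimately have "?f \<longlonglongrightarrow> 0"
    using 0 by (intro Liminf_eq_Limsup) auto
  then show "coarsely_similar A B"
    by (simp add: coarsely_similar_def zero_ereal_def)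
qed

lemma equivp_coarsely_similar: "equivp coarsely_similar"
proof (rule equivpI)
  show "reflp coarsely_similar"
    by (simp add: reflp_def coarsely_similar_def density_upto_def)
  show "symp coarsely_similar"
    by (simp add: symp_def coarsely_similar_def Un_commute)
  show "transp coarsely_similar"
  proof (rule transpI)
    fix A B C
    assume "coarsely_similar A B" "coarsely_similar B C"
    with upper_density_triangle[of A C B] upper_density_nonneg[of "sym_diff A C"]
    show "coarsely_similar A C"
      by (simp add: coarsely_similar_iff_upper_density)
  qed
qed


section \<open>The metric space of coarse similarity classes\<close>

quotient_type coarse = "nat set" / coarsely_similar
  morphisms rep_coarse coarse_class
  by (rule equivp_coarsely_similar)

lemma upper_density_cong:
  assumes "coarsely_similar A A'" "coarsely_similar B B'"
  shows "upper_density (sym_diff A B) = upper_density (sym_diff A' B')"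
proof -
  have "upper_density (sym_diff A A') = 0" "upper_density (sym_diff B B') = 0"
    using assms by (simp_all add: coarsely_similar_iff_upper_density)
  moreover have "upper_density (sym_diff A' A) = upper_density (sym_diff A A')"
    "upper_density (sym_diff B' B) = upper_density (sym_diff B B')"
    by (simp_all add: Un_commute)
  ultimately show ?thesis
    using upper_density_triangle[of A B A'] upper_density_triangle[of A' B B']
      upper_density_triangle[of A' B' A] upper_density_triangle[of A B' B]
    by linarith
qed

instantiation coarse :: metric_space
begin

lift_definition dist_coarse :: "coarse \<Rightarrow> coarse \<Rightarrow> real"
  is "\<lambda>A B. upper_density (sym_diff A B)"
  by (rule upper_density_cong)

definition uniformity_coarse :: "(coarse \<times> coarse) filter" where
  "uniformity_coarse = (INF e\<in>{0<..}. principal {(x, y). dist x y < e})"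

definition open_coarse :: "coarse set \<Rightarrow> bool" where
  "open_coarse S = (\<forall>x\<in>S. \<forall>\<^sub>F (x', y) in uniformity. x' = x \<longrightarrow> y \<in> S)"

instance
proof
  fix x y z :: coarse
  show "dist x y = 0 \<longleftrightarrow> x = y"
    by transfer (simp add: coarsely_similar_iff_upper_density)
  show "dist x y \<le> dist x z + dist y z"
    by transfer (metis Un_commute upper_density_triangle)
qed (simp_all add: uniformity_coarse_def open_coarse_def)

end

lemma dist_coarse_class:
  "dist (coarse_class A) (coarse_class B) = upper_density (sym_diff A B)"
  by (rule dist_coarse.abs_eq)


section \<open>Relative computability\<close>

text \<open>
  Kleene's schemata for the partial recursive functions relative to an oracle. All programs are
  unary; several arguments are packed into one by Cantor's pairing function \<^const>\<open>prod_encode\<close>.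
  In \<open>Minimize\<close> the search diverges if \<open>p\<close> is undefined at some value before the first zero;
  when the guard holds, its witness is the \<open>LEAST\<close> value returned.
\<close>

datatype prog =
    Zero
  | Successor
  | First
  | Second
  | Query
  | Tuple prog prog
  | Compose prog prog
  | PrimRec prog prog
  | Minimize prog

primrec eval :: "nat set \<Rightarrow> prog \<Rightarrow> nat \<Rightarrow> nat option" where
  "eval A Zero = (\<lambda>x. Some 0)"
| "eval A Successor = (\<lambda>x. Some (Suc x))"
| "eval A First = (\<lambda>x. Some (fst (prod_decode x)))"
| "eval A Second = (\<lambda>x. Some (snd (prod_decode x)))"
| "eval A Query = (\<lambda>x. Some (of_bool (x \<in> A)))"
| "eval A (Tuple p q) =
     (\<lambda>x. Option.bind (eval A p x) (\<lambda>y. Option.bind (eval A q x) (\<lambda>z. Some (prod_encode (y, z)))))"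
| "eval A (Compose p q) = (\<lambda>x. Option.bind (eval A q x) (eval A p))"
| "eval A (PrimRec p q) =
     (\<lambda>x. case prod_decode x of (a, n) \<Rightarrow>
        rec_nat (eval A p a)
          (\<lambda>k r. Option.bind r (\<lambda>v. eval A q (prod_encode (a, prod_encode (k, v))))) n)"
| "eval A (Minimize p) =
     (\<lambda>x. if \<exists>y. eval A p (prod_encode (x, y)) = Some 0 \<and>
                 (\<forall>k<y. \<exists>v. eval A p (prod_encode (x, k)) = Some (Suc v))
          then Some (LEAST y. eval A p (prod_encode (x, y)) = Some 0) else None)"

definition turing_le :: "nat set \<Rightarrow> nat set \<Rightarrow> bool" (infix "\<le>\<^sub>T" 50) where
  "A \<le>\<^sub>T B \<longleftrightarrow> (\<exists>p. \<forall>x. eval B p x = Some (of_bool (x \<in> A)))"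

primrec goedel :: "prog \<Rightarrow> nat" where
  "goedel Zero = 0"
| "goedel Successor = 1"
| "goedel First = 2"
| "goedel Second = 3"
| "goedel Query = 4"
| "goedel (Tuple p q) = 5 + 4 * prod_encode (goedel p, goedel q)"
| "goedel (Compose p q) = 6 + 4 * prod_encode (goedel p, goedel q)"
| "goedel (PrimRec p q) = 7 + 4 * prod_encode (goedel p, goedel q)"
| "goedel (Minimize p) = 8 + 4 * goedel p"

text \<open>
  The Turing jump, the halting set relative to \<open>A\<close>. Since \<^const>\<open>goedel\<close> is a bijection
  (see \<open>bij_goedel\<close> below), every natural number is the index of exactly one program.
\<close>

definition jump :: "nat set \<Rightarrow> nat set" where
  "jump A = {goedel p |p. eval A p (goedel p) \<noteq> None}"

definition join :: "nat set \<Rightarrow> nat set \<Rightarrow> nat set" where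
  "join A B = (\<lambda>n. 2 * n) ` A \<union> (\<lambda>n. 2 * n + 1) ` B"

lemma inj_goedel: "inj goedel"
proof (rule injI)
  fix p q assume "goedel p = goedel q"
  then show "p = q"
  proof (induction p arbitrary: q)
    case (Tuple p1 p2) then show ?case by (cases q) (simp_all, presburger+)
  next
    case (Compose p1 p2) then show ?case by (cases q) (simp_all, presburger+)
  next
    case (PrimRec p1 p2) then show ?case by (cases q) (simp_all, presburger+)
  next
    case (Minimize p) then show ?case by (cases q) (simp_all, presburger+)
  qed (case_tac q; simp)+
qed

lemma surj_goedel: "surj goedel"
proof -
  have "\<exists>p. goedel p = n" for n
  proof (induction n rule: less_induct)
    case (less n)
    show ?case
    proof (cases "n < 5")
      case True
      then have "n = 0 \<or> n = 1 \<or> n = 2 \<or> n = 3 \<or> n = 4" by arith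
      then show ?thesis by (metis goedel.simps(1-5))
    next
      case False
      define m where "m = (n - 5) div 4"
      have n: "n = 5 + 4 * m \<or> n = 6 + 4 * m \<or> n = 7 + 4 * m \<or> n = 8 + 4 * m"
        using False unfolding m_def by presburger
      obtain a b where m: "m = prod_encode (a, b)"
        by (metis prod_decode_inverse surj_pair)
      have "a \<le> m" "b \<le> m"
        using m le_prod_encode_1 le_prod_encode_2 by auto
      moreover have "m < n" using n by auto
      ultimately have "a < n" "b < n" by auto
      then obtain p q r where "goedel p = a" "goedel q = b" "goedel r = m"
        using less.IH \<open>m < n\<close> by metis
      then have "goedel (Tuple p q) = 5 + 4 * m" "goedel (Compose p q) = 6 + 4 * m"
        "goedel (PrimRec p q) = 7 + 4 * m" "goedel (Minimize r) = 8 + 4 * m"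
        using m by simp_all
      then show ?thesis using n by metis
    qed
  qed
  then show ?thesis by (metis surjI)
qed

lemma bij_goedel: "bij goedel"
  by (simp add: bij_def inj_goedel surj_goedel)

lemma turing_le_refl: "A \<le>\<^sub>T A"
  unfolding turing_le_def by (rule exI[of _ Query]) simp

primrec subst_query :: "prog \<Rightarrow> prog \<Rightarrow> prog" where
  "subst_query r Zero = Zero"
| "subst_query r Successor = Successor"
| "subst_query r First = First"
| "subst_query r Second = Second"
| "subst_query r Query = r"
| "subst_query r (Tuple p q) = Tuple (subst_query r p) (subst_query r q)"
| "subst_query r (Compose p q) = Compose (subst_query r p) (subst_query r q)"
| "subst_query r (PrimRec p q) = PrimRec (subst_query r p) (subst_query r q)"
| "subst_query r (Minimize p) = Minimize (subst_query r p)"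

lemma eval_subst_query:
  assumes "\<And>x. eval B r x = Some (of_bool (x \<in> A))"
  shows "eval B (subst_query r p) = eval A p"
proof (induction p)
  case Query
  show ?case by (rule ext) (simp add: assms)
next
  case (Minimize p)
  then show ?case by (simp only: eval.simps subst_query.simps)
qed simp_all

lemma turing_le_trans: "A \<le>\<^sub>T B \<Longrightarrow> B \<le>\<^sub>T C \<Longrightarrow> A \<le>\<^sub>T C"
  unfolding turing_le_def by (metis eval_subst_query)


section \<open>Turing ideals and jump-cofinality\<close>

text \<open>
  Only binary joins are required: the empty set is a Turing ideal, and a nonempty family with this
  property contains all computable sets, hence also the empty join.
\<close>

definition turing_ideal :: "nat set set \<Rightarrow> bool" where
  "turing_ideal U \<longleftrightarrow>
     (\<forall>A\<in>U. \<forall>B. B \<le>\<^sub>T A \<longrightarrow> B \<in> U) \<and>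
     (\<forall>A\<in>U. \<forall>B\<in>U. join A B \<in> U)"

definition jump_cofinal :: "nat set set \<Rightarrow> bool" where
  "jump_cofinal U \<longleftrightarrow> (\<forall>X. \<exists>C\<in>U. X \<le>\<^sub>T jump C)"

end

(*
For "closed implies ...", let A_0, A_1, ... be members of U and let S carry a copy of A_j in the
column {2^j (2i+1) | i}. Cutting S off after n columns gives members of U converging to S, so some B
in U is coarsely similar to S, and every column of B is coarsely similar to A_j. If A_j is everything
or nothing according to whether j is in X, the densities of the columns of B decide X in the limit, so
X is computable in the jump of B. If A_j repeats each answer "k in V_j" throughout [2^k, 2^(k+1)),
then V_j is computable from its column of B by majority vote.

For the converse, let B_0, B_1, ... in U converge to C, altered finitely so that B_j and C differ in
at most m / 2^j places below m, for all m. Let E in U bound all B_j. The sequence of E-indices of the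
B_j is computable in the jump of some D in U, hence a limit of D-computable guesses. On
[2^k, 2^(k+1)) let F be the k-th guess at the first stage past k at which the guesses 0, ..., k all
converge and are as close to each other as the true sets would be. The guesses 0, ..., j are
eventually right, which keeps F close to each B_j; so F is coarsely similar to C, and F is computable
from the join of E and D.
*)
theory Submission
  imports Defs
begin

section \<open>Closure properties of relative computability\<close>

abbreviation pfst :: "nat \<Rightarrow> nat" where "pfst x \<equiv> fst (prod_decode x)"
abbreviation psnd :: "nat \<Rightarrow> nat" where "psnd x \<equiv> snd (prod_decode x)"

definition computable_in :: "nat set \<Rightarrow> (nat \<Rightarrow> nat) \<Rightarrow> bool" where
  "computable_in A f \<longleftrightarrow> (\<exists>p. \<forall>x. eval A p x = Some (f x))"

lemma turing_le_iff_computable: "A \<le>\<^sub>T B \<longleftrightarrow> computable_in B (\<lambda>x. of_bool (x \<in> A))"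
  by (simp add: turing_le_def computable_in_def)

lemma computable_in_mono:
  assumes "computable_in A f" "A \<le>\<^sub>T B"
  shows "computable_in B f"
  using assms unfolding computable_in_def turing_le_def by (metis eval_subst_query)

named_theorems comp_intros

lemma computable_compose:
  assumes "computable_in A f" "computable_in A g"
  shows "computable_in A (\<lambda>x. f (g x))"
proof -
  obtain p q where "\<And>x. eval A p x = Some (f x)" "\<And>x. eval A q x = Some (g x)"
    using assms unfolding computable_in_def by blast
  then have "\<forall>x. eval A (Compose p q) x = Some (f (g x))" by simp
  then show ?thesis unfolding computable_in_def by blast
qed

section \<open>Initial functions and primitive recursion\<close>

lemma computable_Suc [comp_intros]: "computable_in A f \<Longrightarrow> computable_in A (\<lambda>x. Suc (f x))"
  by (rule computable_compose[of A Suc]) (auto simp: computable_in_def intro: exI[of _ Successor])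

lemma computable_pfst [comp_intros]: "computable_in A f \<Longrightarrow> computable_in A (\<lambda>x. pfst (f x))"
  by (rule computable_compose[of A pfst]) (auto simp: computable_in_def intro: exI[of _ First])

lemma computable_psnd [comp_intros]: "computable_in A f \<Longrightarrow> computable_in A (\<lambda>x. psnd (f x))"
  by (rule computable_compose[of A psnd]) (auto simp: computable_in_def intro: exI[of _ Second])

lemma computable_oracle [comp_intros]:
  "computable_in A f \<Longrightarrow> computable_in A (\<lambda>x. of_bool (f x \<in> A))"
  by (rule computable_compose[of A "\<lambda>y. of_bool (y \<in> A)"])
    (auto simp: computable_in_def intro: exI[of _ Query])

lemma computable_pair [comp_intros]:
  assumes "computable_in A f" "computable_in A g"
  shows "computable_in A (\<lambda>x. prod_encode (f x, g x))"
proof -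
  obtain p q where "\<And>x. eval A p x = Some (f x)" "\<And>x. eval A q x = Some (g x)"
    using assms unfolding computable_in_def by blast
  then have "\<forall>x. eval A (Tuple p q) x = Some (prod_encode (f x, g x))" by simp
  then show ?thesis unfolding computable_in_def by blast
qed

lemma computable_id [comp_intros]: "computable_in A (\<lambda>x. x)"
proof -
  have "\<forall>x. eval A (Tuple First Second) x = Some x" by simp
  then show ?thesis unfolding computable_in_def by blast
qed

lemma computable_const [comp_intros]: "computable_in A (\<lambda>x. c)"
proof (induction c)
  case 0
  have "\<forall>x. eval A Zero x = Some 0" by simp
  then show ?case unfolding computable_in_def by blast
qed (rule computable_Suc)

text \<open>The parameter \<open>x\<close> is passed through the recursion, so \<open>h\<close> may
  depend on it. The second premise packs \<open>x\<close>, the counter and the previous value just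
  as \<open>PrimRec\<close> hands them to its step program.\<close>

lemma computable_rec_nat [comp_intros]:
  assumes "computable_in A b" "computable_in A (\<lambda>w. h (pfst w) (pfst (psnd w)) (psnd (psnd w)))"
    "computable_in A n"
  shows "computable_in A (\<lambda>x. rec_nat (b x) (h x) (n x))"
proof -
  obtain p q where p: "\<And>x. eval A p x = Some (b x)"
    and q: "\<And>w. eval A q w = Some (h (pfst w) (pfst (psnd w)) (psnd (psnd w)))"
    using assms unfolding computable_in_def by blast
  have "eval A (PrimRec p q) (prod_encode (x, m)) = Some (rec_nat (b x) (h x) m)" for x m
    by (induction m) (simp_all add: p q)
  then have "eval A (PrimRec p q) w = Some (rec_nat (b (pfst w)) (h (pfst w)) (psnd w))" for w
    by (metis prod.collapse prod_decode_inverse)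
  then have "computable_in A (\<lambda>w. rec_nat (b (pfst w)) (h (pfst w)) (psnd w))"
    unfolding computable_in_def by blast
  from computable_compose[OF this computable_pair[OF computable_id assms(3)]]
  show ?thesis by simp
qed

section \<open>Case distinction, arithmetic, predicates and bounded operations\<close>

lemma computable_if [comp_intros]:
  assumes "computable_in A (\<lambda>x. of_bool (P x))" "computable_in A f" "computable_in A g"
  shows "computable_in A (\<lambda>x. if P x then f x else g x)"
proof -
  \<comment> \<open>The truth value serves as the length of the recursion: no step leaves
    \<open>g x\<close>, one step gives \<open>f x\<close>.\<close>
  have "computable_in A (\<lambda>x. rec_nat (g x) (\<lambda>k v. f x) (of_bool (P x)))"
    by (intro assms comp_intros computable_compose[OF assms(2)])
  moreover have "(\<lambda>x. rec_nat (g x) (\<lambda>k v. f x) (of_bool (P x))) = (\<lambda>x. if P x then f x else g x)"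
    by auto
  ultimately show ?thesis by simp
qed

lemma computable_plus [comp_intros]:
  assumes "computable_in A f" "computable_in A g"
  shows "computable_in A (\<lambda>x. f x + g x)"
proof -
  have "rec_nat m (\<lambda>k v. Suc v) n = m + n" for m n by (induction n) auto
  moreover have "computable_in A (\<lambda>x. rec_nat (f x) (\<lambda>k v. Suc v) (g x))"
    by (intro assms comp_intros)
  ultimately show ?thesis by simp
qed

lemma computable_mult [comp_intros]:
  assumes "computable_in A f" "computable_in A g"
  shows "computable_in A (\<lambda>x. f x * g x)"
proof -
  have "rec_nat 0 (\<lambda>k v. v + m) n = m * n" for m n :: nat by (induction n) auto
  moreover have "computable_in A (\<lambda>x. rec_nat 0 (\<lambda>k v. v + f x) (g x))"
    by (intro assms comp_intros computable_compose[OF assms(1)])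
  ultimately show ?thesis by simp
qed

lemma computable_power [comp_intros]:
  assumes "computable_in A f" "computable_in A g"
  shows "computable_in A (\<lambda>x. f x ^ g x)"
proof -
  have "rec_nat 1 (\<lambda>k v. v * m) n = m ^ n" for m n :: nat by (induction n) auto
  moreover have "computable_in A (\<lambda>x. rec_nat 1 (\<lambda>k v. v * f x) (g x))"
    by (intro assms comp_intros computable_compose[OF assms(1)])
  ultimately show ?thesis by simp
qed

lemma computable_minus [comp_intros]:
  assumes "computable_in A f" "computable_in A g"
  shows "computable_in A (\<lambda>x. f x - g x)"
proof -
  \<comment> \<open>A recursion that returns its last counter is the predecessor, with 0 sent to 0;
    iterating it gives truncated subtraction.\<close>
  have pred: "rec_nat 0 (\<lambda>k v. k) n = n - 1" for n :: nat by (cases n) auto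
  have "rec_nat m (\<lambda>k v. rec_nat 0 (\<lambda>k v. k) v) n = m - n" for m n :: nat
    unfolding pred by (induction n) auto
  moreover have "computable_in A (\<lambda>x. rec_nat (f x) (\<lambda>k v. rec_nat 0 (\<lambda>k v. k) v) (g x))"
    by (intro assms comp_intros)
  ultimately show ?thesis by simp
qed

lemma computable_le [comp_intros]:
  assumes "computable_in A f" "computable_in A g"
  shows "computable_in A (\<lambda>x. of_bool (f x \<le> g x))"
proof -
  have "computable_in A (\<lambda>x. 1 - (f x - g x))" by (intro assms comp_intros)
  moreover have "(\<lambda>x. 1 - (f x - g x)) = (\<lambda>x. of_bool (f x \<le> g x))" by auto
  ultimately show ?thesis by simp
qed

lemma computable_not [comp_intros]:
  assumes "computable_in A (\<lambda>x. of_bool (P x))"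
  shows "computable_in A (\<lambda>x. of_bool (\<not> P x))"
proof -
  have "computable_in A (\<lambda>x. 1 - of_bool (P x))" by (intro assms comp_intros)
  moreover have "(\<lambda>x. 1 - of_bool (P x)) = (\<lambda>x. of_bool (\<not> P x) :: nat)" by auto
  ultimately show ?thesis by simp
qed

text \<open>\<open>Minimize\<close> looks for a zero, so it is applied to the negation of
  \<open>P\<close>. That negation is total and a witness always exists, so the guard of
  \<open>Minimize\<close> holds.\<close>

lemma computable_Least:
  assumes "computable_in A (\<lambda>w. of_bool (P (pfst w) (psnd w)))" "\<And>x. \<exists>y. P x y"
  shows "computable_in A (\<lambda>x. LEAST y. P x y)"
proof -
  obtain p where p: "\<And>w. eval A p w = Some (of_bool (\<not> P (pfst w) (psnd w)))"
    using computable_not[OF assms(1)] unfolding computable_in_def by blast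
  have "eval A (Minimize p) x = Some (LEAST y. P x y)" for x
  proof -
    have iff: "eval A p (prod_encode (x, y)) = Some 0 \<longleftrightarrow> P x y" for y by (simp add: p)
    have "P x (LEAST y. P x y)" using assms(2) by (rule LeastI_ex)
    moreover have "\<exists>v. eval A p (prod_encode (x, k)) = Some (Suc v)" if "k < (LEAST y. P x y)" for k
      using not_less_Least[OF that] by (simp add: p)
    ultimately show ?thesis unfolding eval.simps iff by (subst if_P) auto
  qed
  then show ?thesis unfolding computable_in_def by blast
qed

lemma computable_conj [comp_intros]:
  assumes "computable_in A (\<lambda>x. of_bool (P x))" "computable_in A (\<lambda>x. of_bool (Q x))"
  shows "computable_in A (\<lambda>x. of_bool (P x \<and> Q x))"
  unfolding of_bool_conj by (intro assms comp_intros)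

lemma computable_disj [comp_intros]:
  assumes "computable_in A (\<lambda>x. of_bool (P x))" "computable_in A (\<lambda>x. of_bool (Q x))"
  shows "computable_in A (\<lambda>x. of_bool (P x \<or> Q x))"
proof -
  have "computable_in A (\<lambda>x. of_bool (\<not> (\<not> P x \<and> \<not> Q x)))" by (intro assms comp_intros)
  then show ?thesis by simp
qed

lemma computable_iff [comp_intros]:
  assumes "computable_in A (\<lambda>x. of_bool (P x))" "computable_in A (\<lambda>x. of_bool (Q x))"
  shows "computable_in A (\<lambda>x. of_bool (P x \<longleftrightarrow> Q x))"
proof -
  have "computable_in A (\<lambda>x. of_bool (P x \<and> Q x \<or> \<not> P x \<and> \<not> Q x))" by (intro assms comp_intros)
  moreover have "(P x \<and> Q x \<or> \<not> P x \<and> \<not> Q x) \<longleftrightarrow> (P x \<longleftrightarrow> Q x)" for x by blast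
  ultimately show ?thesis by simp
qed

lemma computable_eq [comp_intros]:
  fixes f g :: "nat \<Rightarrow> nat"
  assumes "computable_in A f" "computable_in A g"
  shows "computable_in A (\<lambda>x. of_bool (f x = g x))"
  unfolding order_eq_iff[of "_::nat"] by (intro assms comp_intros)

lemma computable_less [comp_intros]:
  fixes f g :: "nat \<Rightarrow> nat"
  assumes "computable_in A f" "computable_in A g"
  shows "computable_in A (\<lambda>x. of_bool (f x < g x))"
  unfolding less_eq_Suc_le by (intro assms comp_intros)

lemma computable_sum [comp_intros]:
  assumes "computable_in A (\<lambda>w. f (pfst w) (psnd w))" "computable_in A n"
  shows "computable_in A (\<lambda>x. \<Sum>i<n x. f x i)"
proof -
  have "computable_in A (\<lambda>x. rec_nat 0 (\<lambda>k v. v + f x k) (n x))"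
    using computable_compose[OF assms(1), of "\<lambda>w. prod_encode (pfst w, pfst (psnd w))"]
    by (intro assms comp_intros) (simp add: comp_intros)
  moreover have "rec_nat 0 (\<lambda>k v. v + g k) m = sum g {..<m}" for g :: "nat \<Rightarrow> nat" and m
    by (induction m) auto
  ultimately show ?thesis by simp
qed

lemma computable_card [comp_intros]:
  assumes "computable_in A (\<lambda>w. of_bool (P (pfst w) (psnd w)))" "computable_in A n"
  shows "computable_in A (\<lambda>x. card {i. i < n x \<and> P x i})"
proof -
  have "computable_in A (\<lambda>x. \<Sum>i<n x. of_bool (P x i))"
    by (intro assms comp_intros)
  moreover have "(\<Sum>i<m. of_bool (Q i)) = card {i. i < m \<and> Q i}" for Q and m :: nat
    by (simp add: of_bool_def sum.If_cases Int_def)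
  ultimately show ?thesis by simp
qed

lemma computable_ball [comp_intros]:
  assumes "computable_in A (\<lambda>w. of_bool (P (pfst w) (psnd w)))" "computable_in A n"
  shows "computable_in A (\<lambda>x. of_bool (\<forall>i<n x. P x i))"
proof -
  have "computable_in A (\<lambda>x. of_bool (card {i. i < n x \<and> \<not> P x i} = 0))"
    by (intro assms comp_intros)
  moreover have "card {i. i < m \<and> \<not> Q i} = 0 \<longleftrightarrow> (\<forall>i<m. Q i)" for Q and m :: nat
    by (subst card_0_eq) auto
  ultimately show ?thesis by simp
qed

lemma computable_div [comp_intros]:
  assumes "computable_in A f" "computable_in A g"
  shows "computable_in A (\<lambda>x. f x div g x)"
proof -
  \<comment> \<open>The quotient counts the positive multiples of \<open>n\<close> up to
    \<open>m\<close>. For \<open>n = 0\<close> the count would be \<open>m\<close>, whereas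
    \<open>m div 0 = 0\<close>.\<close>
  have eq: "m div n = (if n = 0 then 0 else card {i. i < m \<and> Suc i * n \<le> m})" for m n :: nat
  proof (cases "n = 0")
    case False
    then have "Suc i * n \<le> m \<longleftrightarrow> i < m div n" for i
      by (metis Suc_le_eq less_eq_div_iff_mult_less_eq neq0_conv)
    moreover have "i < m" if "i < m div n" for i
      using that div_le_dividend[of m n] by linarith
    ultimately have "{i. i < m \<and> Suc i * n \<le> m} = {..<m div n}" by auto
    then show ?thesis using False by simp
  qed simp
  show ?thesis unfolding eq
    by (intro assms comp_intros computable_compose[OF assms(1)] computable_compose[OF assms(2)])
qed

lemma computable_mod [comp_intros]:
  assumes "computable_in A f" "computable_in A g"
  shows "computable_in A (\<lambda>x. f x mod g x)"
  unfolding modulo_nat_def by (intro assms comp_intros)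

section \<open>Step-bounded evaluation\<close>

text \<open>
  A stack machine for the schemata. A state is a triple of a stack \<open>K\<close>, a control number and a value;
  control \<open>Suc e\<close> means that the program with index \<open>e\<close> is to be run on the value, control \<open>0\<close>
  that the value is returned to the top frame of \<open>K\<close>. The empty stack is \<open>0\<close>.
\<close>

definition eval_state :: "nat \<Rightarrow> nat \<Rightarrow> nat \<Rightarrow> nat" where
  "eval_state K e x = prod_encode (K, prod_encode (Suc e, x))"

definition return_state :: "nat \<Rightarrow> nat \<Rightarrow> nat" where
  "return_state K v = prod_encode (K, prod_encode (0, v))"

definition push :: "nat \<Rightarrow> nat \<Rightarrow> nat \<Rightarrow> nat" where
  "push tag d K = Suc (prod_encode (prod_encode (tag, d), K))"

text \<open>
  The continuation frames. Writing \<open>e\<^sub>p\<close> for the index of a program \<open>p\<close>, the data \<open>d\<close> of a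
  frame is
  \<^item> tag 0: \<open>(e\<^sub>r, x)\<close>, in \<open>Tuple p r\<close> at \<open>x\<close>, waiting for the value of \<open>p\<close>;
  \<^item> tag 1: the value of \<open>p\<close>, in \<open>Tuple p r\<close>, waiting for that of \<open>r\<close>;
  \<^item> tag 2: \<open>e\<^sub>p\<close>, in \<open>Compose p r\<close>, waiting for the value of \<open>r\<close>;
  \<^item> tag 3: \<open>(e\<^sub>r, a, k, n)\<close>, in \<open>PrimRec p r\<close> at \<open>(a, n)\<close>, waiting for the \<open>k\<close>-th iterate;
  \<^item> tag 4: \<open>(e\<^sub>p, x, k)\<close>, in \<open>Minimize p\<close> at \<open>x\<close>, waiting for the value of \<open>p\<close> at \<open>(x, k)\<close>.
\<close>

definition apply_frame :: "nat \<Rightarrow> nat \<Rightarrow> nat \<Rightarrow> nat \<Rightarrow> nat" where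
  "apply_frame tag d K v =
    (if tag = 0 then eval_state (push 1 v K) (pfst d) (psnd d)
     else if tag = 1 then return_state K (prod_encode (d, v))
     else if tag = 2 then eval_state K d v
     else if tag = 3 then
       (if pfst (psnd (psnd d)) = psnd (psnd (psnd d)) then return_state K v
        else eval_state
          (push 3 (prod_encode (pfst d, prod_encode (pfst (psnd d),
             prod_encode (Suc (pfst (psnd (psnd d))), psnd (psnd (psnd d)))))) K)
          (pfst d) (prod_encode (pfst (psnd d), prod_encode (pfst (psnd (psnd d)), v))))
     else
       (if v = 0 then return_state K (psnd (psnd d))
        else eval_state
          (push 4 (prod_encode (pfst d, prod_encode (pfst (psnd d), Suc (psnd (psnd d))))) K)
          (pfst d) (prod_encode (pfst (psnd d), Suc (psnd (psnd d))))))"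

text \<open>For a compound program with index \<open>e\<close>, the argument \<open>m\<close> is meant to be \<open>(e - 5) div 4\<close>.\<close>

definition eval_step :: "(nat \<Rightarrow> nat) \<Rightarrow> nat \<Rightarrow> nat \<Rightarrow> nat \<Rightarrow> nat \<Rightarrow> nat" where
  "eval_step q e m x K =
    (if e = 0 then return_state K 0
     else if e = 1 then return_state K (Suc x)
     else if e = 2 then return_state K (pfst x)
     else if e = 3 then return_state K (psnd x)
     else if e = 4 then return_state K (q x)
     else if (e - 5) mod 4 = 0 then eval_state (push 0 (prod_encode (psnd m, x)) K) (pfst m) x
     else if (e - 5) mod 4 = 1 then eval_state (push 2 (pfst m) K) (psnd m) x
     else if (e - 5) mod 4 = 2 then
       eval_state (push 3 (prod_encode (psnd m, prod_encode (pfst x, prod_encode (0, psnd x)))) K)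
         (pfst m) (pfst x)
     else eval_state (push 4 (prod_encode (m, prod_encode (x, 0))) K) m (prod_encode (x, 0)))"

text \<open>The oracle is a function rather than a set, so that approximations to an oracle can be
  plugged in stage by stage.\<close>

definition step :: "(nat \<Rightarrow> nat) \<Rightarrow> nat \<Rightarrow> nat" where
  "step q s =
    (if pfst (psnd s) = 0 then
       (if pfst s = 0 then s
        else apply_frame (pfst (pfst (pfst s - 1))) (psnd (pfst (pfst s - 1)))
          (psnd (pfst s - 1)) (psnd (psnd s)))
     else eval_step q (pfst (psnd s) - 1) ((pfst (psnd s) - 1 - 5) div 4) (psnd (psnd s)) (pfst s))"

lemma step_halted [simp]: "step q (return_state 0 v) = return_state 0 v"
  by (simp add: step_def return_state_def)

lemma step_return [simp]: "step q (return_state (push tag d K) v) = apply_frame tag d K v"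
  by (simp add: step_def return_state_def push_def)

lemma step_eval [simp]: "step q (eval_state K e x) = eval_step q e ((e - 5) div 4) x K"
  by (simp add: step_def eval_state_def)

lemma four_times_div_mod:
  fixes m :: nat
  shows "4 * m div 4 = m" "Suc (4 * m) div 4 = m" "Suc (Suc (4 * m)) div 4 = m"
    "Suc (Suc (Suc (4 * m))) div 4 = m" "4 * m mod 4 = 0" "Suc (4 * m) mod 4 = 1"
    "Suc (Suc (4 * m)) mod 4 = 2" "Suc (Suc (Suc (4 * m))) mod 4 = 3"
  by presburger+

lemma eval_step_goedel:
  "eval_step q (goedel Zero) m x K = return_state K 0"
  "eval_step q (goedel Successor) m x K = return_state K (Suc x)"
  "eval_step q (goedel First) m x K = return_state K (pfst x)"
  "eval_step q (goedel Second) m x K = return_state K (psnd x)"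
  "eval_step q (goedel Query) m x K = return_state K (q x)"
  "eval_step q (goedel (Tuple p r)) ((goedel (Tuple p r) - 5) div 4) x K =
     eval_state (push 0 (prod_encode (goedel r, x)) K) (goedel p) x"
  "eval_step q (goedel (Compose p r)) ((goedel (Compose p r) - 5) div 4) x K =
     eval_state (push 2 (goedel p) K) (goedel r) x"
  "eval_step q (goedel (PrimRec p r)) ((goedel (PrimRec p r) - 5) div 4) x K =
     eval_state (push 3 (prod_encode (goedel r, prod_encode (pfst x, prod_encode (0, psnd x)))) K)
       (goedel p) (pfst x)"
  "eval_step q (goedel (Minimize p)) ((goedel (Minimize p) - 5) div 4) x K =
     eval_state (push 4 (prod_encode (goedel p, prod_encode (x, 0))) K) (goedel p) (prod_encode (x, 0))"
  by (simp_all add: eval_step_def four_times_div_mod)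

lemma apply_frame_simps:
  "apply_frame 0 (prod_encode (r, x)) K v = eval_state (push 1 v K) r x"
  "apply_frame 1 y K v = return_state K (prod_encode (y, v))"
  "apply_frame (Suc 0) y K v = return_state K (prod_encode (y, v))"
  "apply_frame 2 e K v = eval_state K e v"
  "apply_frame 3 (prod_encode (r, prod_encode (a, prod_encode (k, n)))) K v =
     (if k = n then return_state K v
      else eval_state (push 3 (prod_encode (r, prod_encode (a, prod_encode (Suc k, n)))) K) r
        (prod_encode (a, prod_encode (k, v))))"
  "apply_frame 4 (prod_encode (r, prod_encode (x, k))) K v =
     (if v = 0 then return_state K k
      else eval_state (push 4 (prod_encode (r, prod_encode (x, Suc k))) K) r (prod_encode (x, Suc k)))"
  by (simp_all add: apply_frame_def)

lemmas step_simps = eval_step_goedel apply_frame_simps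

lemma funpow_halted [simp]: "(step q ^^ t) (return_state 0 v) = return_state 0 v"
  by (induction t) simp_all

section \<open>Agreement of the stack machine with \<open>eval\<close>\<close>

definition reaches :: "nat set \<Rightarrow> nat \<Rightarrow> nat \<Rightarrow> bool" where
  "reaches A s s' \<longleftrightarrow> (\<exists>t. (step (\<lambda>y. of_bool (y \<in> A)) ^^ t) s = s')"

lemma reaches_refl [simp]: "reaches A s s"
  unfolding reaches_def by (rule exI[of _ 0]) simp

lemma reaches_trans: "reaches A s s' \<Longrightarrow> reaches A s' s'' \<Longrightarrow> reaches A s s''"
  unfolding reaches_def by (metis funpow_add comp_apply)

lemma reaches_step: "reaches A (step (\<lambda>y. of_bool (y \<in> A)) s) s' \<Longrightarrow> reaches A s s'"
  unfolding reaches_def by (metis funpow_Suc_right comp_apply)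

lemma Least_search:
  fixes f :: "nat \<Rightarrow> nat option"
  assumes "f y = Some 0" "\<And>j. j < y \<Longrightarrow> \<exists>v. f j = Some (Suc v)"
  shows "(LEAST y. f y = Some 0) = y"
proof (rule Least_equality)
  show "y \<le> z" if "f z = Some 0" for z
    using assms(2)[of z] that by (cases "z < y") auto
qed (rule assms(1))

text \<open>Induction on the program for all stacks at once: a subprogram runs on top of the frame
  that waits for its value. The two loops need an inner induction on the number of rounds.\<close>

lemma reaches_return:
  "eval A p x = Some v \<Longrightarrow> reaches A (eval_state K (goedel p) x) (return_state K v)"
proof (induction p arbitrary: x v K)
  case (Tuple p r)
  from Tuple.prems obtain y z where y: "eval A p x = Some y" and z: "eval A r x = Some z"
    and v: "v = prod_encode (y, z)" by (auto simp: bind_eq_Some_conv)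
  have "reaches A (return_state (push 1 y K) z) (return_state K v)"
    by (rule reaches_step) (simp add: step_simps v)
  with Tuple.IH(2)[OF z] have "reaches A (eval_state (push 1 y K) (goedel r) x) (return_state K v)"
    by (rule reaches_trans)
  then have "reaches A (return_state (push 0 (prod_encode (goedel r, x)) K) y) (return_state K v)"
    by (intro reaches_step[of A "return_state _ _"]) (simp add: step_simps)
  from reaches_trans[OF Tuple.IH(1)[OF y] this]
  show ?case by (intro reaches_step[of A "eval_state _ _ _"]) (simp only: step_eval step_simps)
next
  case (Compose p r)
  from Compose.prems obtain y where y: "eval A r x = Some y" and v: "eval A p y = Some v"
    by (auto simp: bind_eq_Some_conv)
  have "reaches A (return_state (push 2 (goedel p) K) y) (return_state K v)"
    using Compose.IH(1)[OF v] by (intro reaches_step[of A "return_state _ _"]) (simp add: step_simps)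
  from reaches_trans[OF Compose.IH(2)[OF y] this]
  show ?case by (intro reaches_step[of A "eval_state _ _ _"]) (simp only: step_eval step_simps)
next
  case (PrimRec p r)
  obtain a n where x: "x = prod_encode (a, n)" by (metis prod_decode_inverse surj_pair)
  let ?F = "\<lambda>k. push 3 (prod_encode (goedel r, prod_encode (a, prod_encode (k, n)))) K"
  have ev: "eval A (PrimRec p r) (prod_encode (a, Suc k)) = Some v \<Longrightarrow>
      \<exists>w. eval A (PrimRec p r) (prod_encode (a, k)) = Some w
        \<and> eval A r (prod_encode (a, prod_encode (k, w))) = Some v" for k v
    by (auto simp: bind_eq_Some_conv)
  have "eval A (PrimRec p r) (prod_encode (a, k)) = Some w \<Longrightarrow> k \<le> n \<Longrightarrow>
    reaches A (eval_state (?F 0) (goedel p) a) (return_state (?F k) w)" for k w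
  proof (induction k arbitrary: w)
    case 0
    then show ?case using PrimRec.IH(1) by simp
  next
    case (Suc k)
    then obtain u where u: "eval A (PrimRec p r) (prod_encode (a, k)) = Some u"
      "eval A r (prod_encode (a, prod_encode (k, u))) = Some w" using ev by blast
    have "reaches A (return_state (?F k) u) (return_state (?F (Suc k)) w)"
      using PrimRec.IH(2)[OF u(2)] Suc.prems(2)
      by (intro reaches_step[of A "return_state _ _"]) (simp add: step_simps)
    moreover have "reaches A (eval_state (?F 0) (goedel p) a) (return_state (?F k) u)"
      using Suc.IH[OF u(1)] Suc.prems(2) by simp
    ultimately show ?case by (rule reaches_trans[rotated])
  qed
  from this[of n v] PrimRec.prems
  have "reaches A (eval_state (?F 0) (goedel p) a) (return_state (?F n) v)"
    unfolding x by blast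
  moreover have "reaches A (return_state (?F n) v) (return_state K v)"
    by (rule reaches_step) (simp add: step_simps)
  ultimately have "reaches A (eval_state (?F 0) (goedel p) a) (return_state K v)"
    by (rule reaches_trans)
  then show ?case
    by (intro reaches_step[of A "eval_state _ _ _"])
      (simp only: step_eval step_simps x prod_encode_inverse fst_conv snd_conv)
next
  case (Minimize p)
  let ?F = "\<lambda>k. push 4 (prod_encode (goedel p, prod_encode (x, k))) K"
  from Minimize.prems have ex: "\<exists>y. eval A p (prod_encode (x, y)) = Some 0 \<and>
      (\<forall>k<y. \<exists>v. eval A p (prod_encode (x, k)) = Some (Suc v))"
    and v: "v = (LEAST y. eval A p (prod_encode (x, y)) = Some 0)"
    by (auto split: if_splits)
  then obtain y where y: "eval A p (prod_encode (x, y)) = Some 0"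
    "\<And>k. k < y \<Longrightarrow> \<exists>v. eval A p (prod_encode (x, k)) = Some (Suc v)" by blast
  have "(LEAST y. eval A p (prod_encode (x, y)) = Some 0) = y"
    using y by (intro Least_search) auto
  then have vy: "v = y" using v by simp
  \<comment> \<open>Before round \<open>y\<close> every value is positive, so the frame restarts the
    search with the next candidate.\<close>
  have "k \<le> y \<Longrightarrow> reaches A (eval_state (?F 0) (goedel p) (prod_encode (x, 0)))
      (eval_state (?F k) (goedel p) (prod_encode (x, k)))" for k
  proof (induction k)
    case (Suc k)
    then obtain w where w: "eval A p (prod_encode (x, k)) = Some (Suc w)" using y(2) by force
    have "reaches A (return_state (?F k) (Suc w)) (eval_state (?F (Suc k)) (goedel p) (prod_encode (x, Suc k)))"
      by (rule reaches_step) (simp add: step_simps)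
    with Minimize.IH[OF w, of "?F k"] Suc show ?case
      by (meson Suc_leD reaches_trans)
  qed simp
  from this[of y] have "reaches A (eval_state (?F 0) (goedel p) (prod_encode (x, 0)))
      (eval_state (?F y) (goedel p) (prod_encode (x, y)))" by simp
  moreover note Minimize.IH[OF y(1), of "?F y"]
  moreover have "reaches A (return_state (?F y) 0) (return_state K v)"
    by (rule reaches_step) (simp add: step_simps vy)
  ultimately have "reaches A (eval_state (?F 0) (goedel p) (prod_encode (x, 0))) (return_state K v)"
    by (meson reaches_trans)
  then show ?case
    by (intro reaches_step[of A "eval_state _ _ _"]) (simp only: step_eval step_simps)
qed (rule reaches_step; simp only: step_eval step_simps; simp)+

definition halts_in :: "nat set \<Rightarrow> nat \<Rightarrow> nat \<Rightarrow> nat \<Rightarrow> bool" where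
  "halts_in A w n s \<longleftrightarrow> (step (\<lambda>y. of_bool (y \<in> A)) ^^ n) s = return_state 0 w"

lemma halts_in_eval:
  assumes "halts_in A w n (eval_state K (goedel p) x)"
  obtains m where "m < n"
    "halts_in A w m (eval_step (\<lambda>y. of_bool (y \<in> A)) (goedel p) ((goedel p - 5) div 4) x K)"
proof (cases n)
  case 0
  then show ?thesis using assms by (simp add: halts_in_def eval_state_def return_state_def)
next
  case (Suc m)
  then show ?thesis using assms that[of m]
    by (simp add: halts_in_def funpow_Suc_right del: funpow.simps)
qed

lemma halts_in_return:
  assumes "halts_in A w n (return_state (push t d K) v)"
  obtains m where "m < n" "halts_in A w m (apply_frame t d K v)"
proof (cases n)
  case 0
  then show ?thesis using assms by (simp add: halts_in_def push_def return_state_def)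
next
  case (Suc m)
  then show ?thesis using assms that[of m]
    by (simp add: halts_in_def funpow_Suc_right del: funpow.simps)
qed

text \<open>The machine halts only on the empty stack, so a halting run must return a value to
  \<open>K\<close> on the way. Recording that strictly fewer steps remain at that moment supplies
  the measure for unbounded search.\<close>

lemma halts_in_imp_eval:
  assumes "halts_in A w n (eval_state K (goedel p) x)"
  shows "\<exists>v m. m < n \<and> eval A p x = Some v \<and> halts_in A w m (return_state K v)"
  using assms
proof (induction p arbitrary: n K x)
  case (Tuple p r)
  from Tuple.prems obtain n1 where n1: "n1 < n"
    "halts_in A w n1 (eval_state (push 0 (prod_encode (goedel r, x)) K) (goedel p) x)"
    by (rule halts_in_eval) (simp only: step_simps)
  from Tuple.IH(1)[OF n1(2)] obtain y n2 where y: "n2 < n1" "eval A p x = Some y"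
    "halts_in A w n2 (return_state (push 0 (prod_encode (goedel r, x)) K) y)" by blast
  from y(3) obtain n3 where n3: "n3 < n2" "halts_in A w n3 (eval_state (push 1 y K) (goedel r) x)"
    by (rule halts_in_return) (simp only: step_simps)
  from Tuple.IH(2)[OF n3(2)] obtain z n4 where z: "n4 < n3" "eval A r x = Some z"
    "halts_in A w n4 (return_state (push 1 y K) z)" by blast
  from z(3) obtain n5 where n5: "n5 < n4" "halts_in A w n5 (return_state K (prod_encode (y, z)))"
    by (rule halts_in_return) (simp only: step_simps)
  show ?case using n1(1) y(1,2) n3(1) z(1,2) n5 by (auto intro!: exI[of _ n5])
next
  case (Compose p r)
  from Compose.prems obtain n1 where n1: "n1 < n"
    "halts_in A w n1 (eval_state (push 2 (goedel p) K) (goedel r) x)"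
    by (rule halts_in_eval) (simp only: step_simps)
  from Compose.IH(2)[OF n1(2)] obtain y n2 where y: "n2 < n1" "eval A r x = Some y"
    "halts_in A w n2 (return_state (push 2 (goedel p) K) y)" by blast
  from y(3) obtain n3 where n3: "n3 < n2" "halts_in A w n3 (eval_state K (goedel p) y)"
    by (rule halts_in_return) (simp only: step_simps)
  from Compose.IH(1)[OF n3(2)] obtain z n4 where z: "n4 < n3" "eval A p y = Some z"
    "halts_in A w n4 (return_state K z)" by blast
  show ?case using n1(1) y(1,2) n3(1) z by (auto intro!: exI[of _ n4])
next
  case (PrimRec p r)
  obtain a l where x: "x = prod_encode (a, l)" by (metis prod_decode_inverse surj_pair)
  let ?F = "\<lambda>k. push 3 (prod_encode (goedel r, prod_encode (a, prod_encode (k, l)))) K"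
  from PrimRec.prems obtain n1 where n1: "n1 < n" "halts_in A w n1 (eval_state (?F 0) (goedel p) a)"
    by (rule halts_in_eval) (simp only: step_simps x prod_encode_inverse fst_conv snd_conv)
  have "k \<le> l \<Longrightarrow> \<exists>u m. m < n1 \<and> eval A (PrimRec p r) (prod_encode (a, k)) = Some u
      \<and> halts_in A w m (return_state (?F k) u)" for k
  proof (induction k)
    case 0
    then show ?case using PrimRec.IH(1)[OF n1(2)] by auto
  next
    case (Suc k)
    then obtain u m where u: "m < n1" "eval A (PrimRec p r) (prod_encode (a, k)) = Some u"
      "halts_in A w m (return_state (?F k) u)" by auto
    from u(3) obtain m1 where m1: "m1 < m"
      "halts_in A w m1 (eval_state (?F (Suc k)) (goedel r) (prod_encode (a, prod_encode (k, u))))"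
      using Suc.prems by (auto elim!: halts_in_return simp: step_simps split: if_splits)
    from PrimRec.IH(2)[OF m1(2)] obtain v m2 where v: "m2 < m1"
      "eval A r (prod_encode (a, prod_encode (k, u))) = Some v"
      "halts_in A w m2 (return_state (?F (Suc k)) v)" by blast
    show ?case using u(1,2) m1(1) v by (auto intro!: exI[of _ m2])
  qed
  from this[of l] obtain v m where v: "m < n1" "eval A (PrimRec p r) x = Some v"
    "halts_in A w m (return_state (?F l) v)" unfolding x by auto
  from v(3) obtain m1 where "m1 < m" "halts_in A w m1 (return_state K v)"
    by (rule halts_in_return) (simp add: step_simps)
  then show ?case using v(1,2) n1(1) by (meson less_trans)
next
  case (Minimize p)
  let ?F = "\<lambda>k. push 4 (prod_encode (goedel p, prod_encode (x, k))) K"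
  from Minimize.prems obtain n1 where n1: "n1 < n"
    "halts_in A w n1 (eval_state (?F 0) (goedel p) (prod_encode (x, 0)))"
    by (rule halts_in_eval) (simp only: step_simps)
  \<comment> \<open>Induction on the remaining running time \<open>l\<close>: each unsuccessful
    candidate uses up steps, so a halting run tests only finitely many.\<close>
  have "halts_in A w l (eval_state (?F k) (goedel p) (prod_encode (x, k))) \<Longrightarrow>
     \<exists>y m. m < l \<and> k \<le> y \<and> eval A p (prod_encode (x, y)) = Some 0 \<and>
       (\<forall>j. k \<le> j \<longrightarrow> j < y \<longrightarrow> (\<exists>v. eval A p (prod_encode (x, j)) = Some (Suc v))) \<and>
       halts_in A w m (return_state K y)" for l k
  proof (induction l arbitrary: k rule: less_induct)
    case (less l)
    from Minimize.IH[OF less.prems] obtain v m where v: "m < l"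
      "eval A p (prod_encode (x, k)) = Some v" "halts_in A w m (return_state (?F k) v)" by blast
    from v(3) obtain m1 where m1: "m1 < m" "halts_in A w m1
      (if v = 0 then return_state K k else eval_state (?F (Suc k)) (goedel p) (prod_encode (x, Suc k)))"
      by (rule halts_in_return) (simp add: step_simps)
    show ?case
    proof (cases v)
      case 0
      then show ?thesis using v m1 by (intro exI[of _ k] exI[of _ m1]) auto
    next
      case (Suc v')
      with m1 have "halts_in A w m1 (eval_state (?F (Suc k)) (goedel p) (prod_encode (x, Suc k)))"
        by simp
      from less.IH[OF _ this] v(1) m1(1) obtain y m2 where y: "m2 < m1" "Suc k \<le> y"
        "eval A p (prod_encode (x, y)) = Some 0"
        "\<forall>j. Suc k \<le> j \<longrightarrow> j < y \<longrightarrow> (\<exists>v. eval A p (prod_encode (x, j)) = Some (Suc v))"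
        "halts_in A w m2 (return_state K y)" by auto
      have "\<forall>j. k \<le> j \<longrightarrow> j < y \<longrightarrow> (\<exists>v. eval A p (prod_encode (x, j)) = Some (Suc v))"
        using y(4) v(2) Suc by (metis Suc_leI le_neq_implies_less)
      then show ?thesis using y v(1) m1(1) by (intro exI[of _ y] exI[of _ m2]) auto
    qed
  qed
  from this[OF n1(2)] obtain y m where y: "m < n1" "eval A p (prod_encode (x, y)) = Some 0"
       "\<forall>j<y. \<exists>v. eval A p (prod_encode (x, j)) = Some (Suc v)"
       "halts_in A w m (return_state K y)" by auto
  have "(LEAST y. eval A p (prod_encode (x, y)) = Some 0) = y"
    using y by (intro Least_search) auto
  with y have "eval A (Minimize p) x = Some y" by auto
  then show ?case using y(1,4) n1(1) by (meson less_trans)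
qed (elim halts_in_eval; simp only: step_simps; force)+

lemma eval_iff_halts:
  "eval A p x = Some v \<longleftrightarrow>
    (\<exists>t. (step (\<lambda>y. of_bool (y \<in> A)) ^^ t) (eval_state 0 (goedel p) x) = return_state 0 v)"
proof
  assume "eval A p x = Some v"
  then show "\<exists>t. (step (\<lambda>y. of_bool (y \<in> A)) ^^ t) (eval_state 0 (goedel p) x) = return_state 0 v"
    using reaches_return unfolding reaches_def by blast
next
  assume "\<exists>t. (step (\<lambda>y. of_bool (y \<in> A)) ^^ t) (eval_state 0 (goedel p) x) = return_state 0 v"
  then obtain t where "halts_in A v t (eval_state 0 (goedel p) x)" unfolding halts_in_def by blast
  from halts_in_imp_eval[OF this] obtain u m where
    "eval A p x = Some u" "halts_in A v m (return_state 0 u)" by blast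
  moreover from this(2) have "u = v"
    unfolding halts_in_def funpow_halted by (simp add: return_state_def)
  ultimately show "eval A p x = Some v" by simp
qed

text \<open>\<open>0\<close> stands for a computation that has not halted, \<open>Suc v\<close> for the value \<open>v\<close>.\<close>

definition halted_output :: "nat \<Rightarrow> nat" where
  "halted_output s = (if pfst s = 0 \<and> pfst (psnd s) = 0 then Suc (psnd (psnd s)) else 0)"

definition bounded_eval :: "(nat \<Rightarrow> nat) \<Rightarrow> nat \<Rightarrow> nat \<Rightarrow> nat \<Rightarrow> nat" where
  "bounded_eval q e x t = halted_output ((step q ^^ t) (eval_state 0 e x))"

lemma halted_output_eq_Suc_iff: "halted_output s = Suc v \<longleftrightarrow> s = return_state 0 v"
proof
  assume "halted_output s = Suc v"
  then have "pfst s = 0" "pfst (psnd s) = 0" "psnd (psnd s) = v"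
    by (auto simp: halted_output_def split: if_splits)
  then show "s = return_state 0 v"
    unfolding return_state_def by (metis prod.collapse prod_decode_inverse)
qed (simp add: halted_output_def return_state_def)

lemma bounded_eval_mono:
  assumes "bounded_eval q e x t = Suc v" "t \<le> t'"
  shows "bounded_eval q e x t' = Suc v"
proof -
  have "(step q ^^ t') s = (step q ^^ (t' - t)) ((step q ^^ t) s)" for s
    using assms(2) by (metis comp_apply funpow_add le_add_diff_inverse2)
  with assms(1) show ?thesis unfolding bounded_eval_def halted_output_eq_Suc_iff by simp
qed

lemma eval_iff_bounded_eval:
  "eval A p x = Some v \<longleftrightarrow> (\<exists>t. bounded_eval (\<lambda>y. of_bool (y \<in> A)) (goedel p) x t = Suc v)"
  unfolding bounded_eval_def halted_output_eq_Suc_iff by (rule eval_iff_halts)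

lemma eventually_bounded_eval:
  assumes "eval A p x = Some v"
  shows "\<forall>\<^sub>F t in sequentially. bounded_eval (\<lambda>y. of_bool (y \<in> A)) (goedel p) x t = Suc v"
  using assms unfolding eval_iff_bounded_eval eventually_sequentially by (meson bounded_eval_mono)

lemma step_cong: "q (psnd (psnd s)) = r (psnd (psnd s)) \<Longrightarrow> step q s = step r s"
  by (simp add: step_def eval_step_def)

text \<open>A computation of fixed length asks only finitely many oracle questions.\<close>

lemma bounded_eval_eventually_eq:
  assumes "\<And>y. \<forall>\<^sub>F s in F. q s y = r y"
  shows "\<forall>\<^sub>F s in F. bounded_eval (q s) e x t = bounded_eval r e x t"
proof -
  have "\<forall>\<^sub>F s in F. (step (q s) ^^ t) (eval_state 0 e x) = (step r ^^ t) (eval_state 0 e x)"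
  proof (induction t)
    case (Suc t)
    let ?y = "psnd (psnd ((step r ^^ t) (eval_state 0 e x)))"
    from Suc assms[of ?y] show ?case
    proof eventually_elim
      case (elim s)
      then show ?case using step_cong[of "q s" _ r] by simp
    qed
  qed simp
  then show ?thesis by eventually_elim (simp add: bounded_eval_def)
qed

section \<open>Computability of the machine itself\<close>

lemma computable_eval_state [comp_intros]:
  assumes "computable_in A K" "computable_in A e" "computable_in A f"
  shows "computable_in A (\<lambda>x. eval_state (K x) (e x) (f x))"
  unfolding eval_state_def by (intro assms comp_intros)

lemma computable_return_state [comp_intros]:
  assumes "computable_in A K" "computable_in A f"
  shows "computable_in A (\<lambda>x. return_state (K x) (f x))"
  unfolding return_state_def by (intro assms comp_intros)

lemma computable_push [comp_intros]:
  assumes "computable_in A t" "computable_in A d" "computable_in A K"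
  shows "computable_in A (\<lambda>x. push (t x) (d x) (K x))"
  unfolding push_def by (intro assms comp_intros)

lemma computable_apply_frame [comp_intros]:
  assumes "computable_in A t" "computable_in A d" "computable_in A K" "computable_in A v"
  shows "computable_in A (\<lambda>x. apply_frame (t x) (d x) (K x) (v x))"
  unfolding apply_frame_def by (intro assms comp_intros)

lemma computable_compose2:
  assumes "computable_in A (\<lambda>w. f (pfst w) (psnd w))" "computable_in A g" "computable_in A h"
  shows "computable_in A (\<lambda>x. f (g x) (h x))"
  using computable_compose[OF assms(1) computable_pair[OF assms(2,3)]] by simp

lemma computable_eval_step:
  assumes "computable_in A (\<lambda>w. q (pfst w) (psnd w))" "computable_in A c" "computable_in A e"
    "computable_in A m" "computable_in A f" "computable_in A K"
  shows "computable_in A (\<lambda>x. eval_step (q (c x)) (e x) (m x) (f x) (K x))"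
  unfolding eval_step_def by (intro assms comp_intros computable_compose2[OF assms(1)])

lemma computable_step:
  assumes "computable_in A (\<lambda>w. q (pfst w) (psnd w))" "computable_in A c" "computable_in A s"
  shows "computable_in A (\<lambda>x. step (q (c x)) (s x))"
  unfolding step_def by (intro assms comp_intros computable_eval_step[OF assms(1)])

text \<open>The oracle may vary with the argument through \<open>c\<close>. In the limit lemma this
  parameter is the stage of the approximation to the jump.\<close>

lemma computable_bounded_eval:
  assumes "computable_in A (\<lambda>w. q (pfst w) (psnd w))" "computable_in A c" "computable_in A e"
    "computable_in A f" "computable_in A t"
  shows "computable_in A (\<lambda>x. bounded_eval (q (c x)) (e x) (f x) (t x))"
proof -
  have "computable_in A (\<lambda>x. rec_nat (eval_state 0 (e x) (f x)) (\<lambda>k. step (q (c x))) (t x))"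
    by (intro assms comp_intros computable_step[OF assms(1)] computable_compose[OF assms(2)])
  moreover have "rec_nat s (\<lambda>k. step r) n = (step r ^^ n) s" for r s n
    by (induction n) auto
  ultimately have "computable_in A (\<lambda>x. (step (q (c x)) ^^ t x) (eval_state 0 (e x) (f x)))"
    by simp
  then show ?thesis unfolding bounded_eval_def halted_output_def by (intro comp_intros)
qed

lemma computable_bounded_eval_oracle [comp_intros]:
  assumes "computable_in A e" "computable_in A f" "computable_in A t"
  shows "computable_in A (\<lambda>x. bounded_eval (\<lambda>y. of_bool (y \<in> A)) (e x) (f x) (t x))"
  by (intro assms comp_intros computable_bounded_eval[where c="\<lambda>x. 0"])

section \<open>The limit lemma\<close>

lemma in_jump_iff:
  "e \<in> jump A \<longleftrightarrow> (\<exists>t. bounded_eval (\<lambda>y. of_bool (y \<in> A)) e e t \<noteq> 0)"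
proof -
  obtain p where e: "e = goedel p" using surj_goedel by (metis surjD)
  have "e \<in> jump A \<longleftrightarrow> (\<exists>v. eval A p e = Some v)"
    using inj_goedel by (auto simp: jump_def e inj_def)
  also have "\<dots> \<longleftrightarrow> (\<exists>t v. bounded_eval (\<lambda>y. of_bool (y \<in> A)) e e t = Suc v)"
    unfolding eval_iff_bounded_eval e by blast
  moreover have "k \<noteq> 0 \<longleftrightarrow> (\<exists>v. k = Suc v)" for k :: nat by (cases k) auto
  ultimately show ?thesis by (simp only:)
qed

text \<open>At stage \<open>s\<close> the jump is replaced by the set of programs seen to halt
  within \<open>s\<close> steps, and the reduction is run for \<open>s\<close> steps. The true
  computation asks finitely many questions, all of which are answered correctly from some stage
  on.\<close>

lemma limit_computable_if_le_jump:
  assumes "X \<le>\<^sub>T jump D"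
  obtains g where "computable_in D (\<lambda>w. g (pfst w) (psnd w))"
    "\<And>n. \<forall>\<^sub>F s in sequentially. g n s = of_bool (n \<in> X)"
proof -
  obtain p where p: "\<And>n. eval (jump D) p n = Some (of_bool (n \<in> X))"
    using assms unfolding turing_le_def by blast
  define q :: "nat \<Rightarrow> nat \<Rightarrow> nat" where "q s e = of_bool (bounded_eval (\<lambda>y. of_bool (y \<in> D)) e e s \<noteq> 0)" for s e
  have q: "\<forall>\<^sub>F s in sequentially. q s e = of_bool (e \<in> jump D)" for e
  proof (cases "e \<in> jump D")
    case True
    then obtain t v where "bounded_eval (\<lambda>y. of_bool (y \<in> D)) e e t = Suc v"
      unfolding in_jump_iff by (metis not0_implies_Suc)
    from bounded_eval_mono[OF this] have "\<forall>s\<ge>t. q s e = of_bool (e \<in> jump D)"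
      using True by (simp add: q_def)
    then show ?thesis unfolding eventually_sequentially by blast
  next
    case False
    then show ?thesis by (auto simp: q_def in_jump_iff)
  qed
  \<comment> \<open>Subtracting 1 removes the shift in \<open>bounded_eval\<close>; an unfinished
    computation yields the default guess 0.\<close>
  define g where "g n s = bounded_eval (q s) (goedel p) n s - 1" for n s
  show thesis
  proof
    have "computable_in D (\<lambda>w. q (pfst w) (psnd w))"
      unfolding q_def by (intro comp_intros)
    then show "computable_in D (\<lambda>w. g (pfst w) (psnd w))"
      unfolding g_def by (intro comp_intros computable_bounded_eval)
    fix n
    obtain t where t: "bounded_eval (\<lambda>y. of_bool (y \<in> jump D)) (goedel p) n t = Suc (of_bool (n \<in> X))"
      using p[of n] unfolding eval_iff_bounded_eval by blast
    have "\<forall>\<^sub>F s in sequentially. bounded_eval (q s) (goedel p) n t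
        = bounded_eval (\<lambda>y. of_bool (y \<in> jump D)) (goedel p) n t"
      by (rule bounded_eval_eventually_eq) (rule q)
    with eventually_ge_at_top[of t] show "\<forall>\<^sub>F s in sequentially. g n s = of_bool (n \<in> X)"
    proof eventually_elim
      case (elim s)
      then show ?case using t bounded_eval_mono[of "q s" "goedel p" n t _ s] by (simp add: g_def)
    qed
  qed
qed

primrec const_prog :: "nat \<Rightarrow> prog" where
  "const_prog 0 = Zero"
| "const_prog (Suc n) = Compose Successor (const_prog n)"

lemma eval_const_prog [simp]: "eval A (const_prog n) x = Some n"
  by (induction n) simp_all

lemma computable_goedel_const_prog [comp_intros]:
  assumes "computable_in A f"
  shows "computable_in A (\<lambda>x. goedel (const_prog (f x)))"
proof -
  have "goedel (const_prog n) = rec_nat 0 (\<lambda>k v. 6 + 4 * prod_encode (1, v)) n" for n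
    by (induction n) simp_all
  then show ?thesis by (simp only:) (intro assms comp_intros)
qed

text \<open>
  The program searching for \<open>y\<close> with \<open>n\<close> hard-wired ignores its input, so it halts on its own
  index iff the search succeeds.
\<close>

lemma search_le_jump:
  assumes "computable_in A (\<lambda>w. of_bool (P (pfst w) (psnd w)))"
  shows "{n. \<exists>y. P n y} \<le>\<^sub>T jump A"
proof -
  obtain p where p: "\<And>w. eval A p w = Some (of_bool (\<not> P (pfst w) (psnd w)))"
    using computable_not[OF assms] unfolding computable_in_def by blast
  define h where "h n = goedel (Compose (Minimize p) (const_prog n))" for n
  have halt: "eval A (Minimize p) n \<noteq> None \<longleftrightarrow> (\<exists>y. P n y)" for n
  proof
    assume "\<exists>y. P n y"
    then obtain y where "P n y" "\<And>k. k < y \<Longrightarrow> \<not> P n k" by (metis exists_least_iff)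
    then have "eval A p (prod_encode (n, y)) = Some 0 \<and>
        (\<forall>k<y. \<exists>v. eval A p (prod_encode (n, k)) = Some (Suc v))"
      by (simp add: p)
    then have "\<exists>y. eval A p (prod_encode (n, y)) = Some 0 \<and>
        (\<forall>k<y. \<exists>v. eval A p (prod_encode (n, k)) = Some (Suc v))"
      by (rule exI)
    then show "eval A (Minimize p) n \<noteq> None" by (simp only: eval.simps if_True) simp
  qed (auto simp: p split: if_splits)
  have "h n \<in> jump A \<longleftrightarrow> (\<exists>y. P n y)" for n
  proof -
    have "h n \<in> jump A \<longleftrightarrow> eval A (Compose (Minimize p) (const_prog n)) (h n) \<noteq> None"
      using inj_goedel unfolding jump_def h_def by (auto simp only: inj_eq mem_Collect_eq)
    also have "eval A (Compose (Minimize p) (const_prog n)) (h n) = eval A (Minimize p) n"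
      by (simp only: eval.simps(7) eval_const_prog bind.simps)
    finally show ?thesis using halt by simp
  qed
  moreover have "computable_in (jump A) (\<lambda>n. of_bool (h n \<in> jump A))"
    unfolding h_def goedel.simps by (intro comp_intros)
  ultimately show ?thesis by (simp add: turing_le_iff_computable)
qed

text \<open>A search whose condition ignores the candidate succeeds iff \<open>n\<close> lies in
  \<open>A\<close>.\<close>

lemma le_jump: "A \<le>\<^sub>T jump A"
proof -
  have "{n. \<exists>y::nat. n \<in> A} \<le>\<^sub>T jump A"
    by (rule search_le_jump) (intro comp_intros)
  then show ?thesis by simp
qed

text \<open>Whether a guess will ever differ from its present value is a search question, hence
  decided by the jump. So the jump can find a stage whose guess is final.\<close>

lemma le_jump_if_limit_computable:
  assumes g: "computable_in A (\<lambda>w. g (pfst w) (psnd w))"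
    and lim: "\<And>n. \<forall>\<^sub>F s in sequentially. g n s = of_bool (n \<in> X)"
  shows "X \<le>\<^sub>T jump A"
proof -
  define C where "C = {w. \<exists>y. g (pfst w) (psnd w + y) \<noteq> g (pfst w) (psnd w)}"
  have C: "C \<le>\<^sub>T jump A" unfolding C_def
    by (rule search_le_jump) (intro comp_intros computable_compose2[OF g])
  define m where "m n = (LEAST s. prod_encode (n, s) \<notin> C)" for n
  have ex: "\<exists>s. prod_encode (n, s) \<notin> C" for n
    using lim[of n] unfolding eventually_sequentially C_def by auto (metis le_add1 le_refl)
  then have "prod_encode (n, m n) \<notin> C" for n unfolding m_def by (rule LeastI_ex)
  then have stable: "g n (m n + y) = g n (m n)" for n y by (simp add: C_def)
  have "g n (m n) = of_bool (n \<in> X)" for n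
  proof -
    obtain s where "\<forall>t\<ge>s. g n t = of_bool (n \<in> X)"
      using lim[of n] unfolding eventually_sequentially by blast
    then show ?thesis using stable[of n s] by simp
  qed
  moreover have "computable_in (jump A) (\<lambda>n. g n (m n))"
  proof (rule computable_compose2[of _ g])
    show "computable_in (jump A) (\<lambda>w. g (pfst w) (psnd w))"
      using g le_jump by (rule computable_in_mono)
    have "computable_in C (\<lambda>n. LEAST s. prod_encode (n, s) \<notin> C)"
      by (intro computable_Least comp_intros ex)
    then show "computable_in (jump A) m"
      unfolding m_def using C by (rule computable_in_mono)
  qed (rule computable_id)
  ultimately show ?thesis by (simp add: turing_le_iff_computable)
qed

section \<open>Columns and blocks\<close>

text \<open>This moves closedness from classes to sets. The limit \<open>C\<close> itself need not
  belong to \<open>U\<close>, only some set in its class.\<close>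

lemma closed_coarse_class_image_iff:
  "closed (coarse_class ` U) \<longleftrightarrow>
    (\<forall>C. (\<forall>e>0. \<exists>A\<in>U. upper_density (sym_diff A C) < e) \<longrightarrow> (\<exists>A\<in>U. coarsely_similar A C))"
proof -
  have dist: "(\<exists>y\<in>coarse_class ` U. dist y (coarse_class C) < e) \<longleftrightarrow>
      (\<exists>A\<in>U. upper_density (sym_diff A C) < e)" for C e
    by (simp add: dist_coarse_class)
  have mem: "coarse_class C \<in> coarse_class ` U \<longleftrightarrow> (\<exists>A\<in>U. coarsely_similar A C)" for C
    by (auto simp: coarse.abs_eq_iff image_iff dest: equivp_symp[OF equivp_coarsely_similar])
  have "closed S \<longleftrightarrow> (\<forall>x. (\<forall>e>0. \<exists>y\<in>S. dist y x < e) \<longrightarrow> x \<in> S)" for S :: "coarse set"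
    unfolding closure_subset_eq[symmetric] subset_iff closure_approachable ..
  moreover have "(\<forall>x. Q x) \<longleftrightarrow> (\<forall>C. Q (coarse_class C))" for Q
    using coarse.abs_induct by blast
  ultimately show ?thesis by (simp only: dist mem)
qed

lemma upper_density_leI:
  assumes "\<forall>\<^sub>F n in sequentially. density_upto n A \<le> e"
  shows "upper_density A \<le> e"
proof -
  have "limsup (\<lambda>n. ereal (density_upto n A)) \<le> ereal e"
    using assms by (intro Limsup_bounded) simp
  then show ?thesis by (simp flip: ereal_upper_density)
qed

lemma eventually_density_less:
  assumes "upper_density A < e"
  shows "\<forall>\<^sub>F n in sequentially. density_upto n A < e"
proof -
  have "limsup (\<lambda>n. ereal (density_upto n A)) < ereal e"
    using assms by (simp flip: ereal_upper_density)
  from Limsup_lessD[OF this] show ?thesis by simp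
qed

lemma eventually_card_less:
  fixes e :: real
  assumes "upper_density A < e"
  shows "\<forall>\<^sub>F n in sequentially. real (card (A \<inter> {0..<n})) < e * real n"
  using eventually_density_less[OF assms] eventually_gt_at_top[of 0]
  by eventually_elim (simp add: density_upto_def field_simps)

section \<open>Ideals and joins\<close>

lemma turing_ideal_le: "turing_ideal U \<Longrightarrow> A \<in> U \<Longrightarrow> B \<le>\<^sub>T A \<Longrightarrow> B \<in> U"
  unfolding turing_ideal_def by blast

lemma turing_ideal_computable:
  "turing_ideal U \<Longrightarrow> A \<in> U \<Longrightarrow> computable_in A (\<lambda>x. of_bool (x \<in> B)) \<Longrightarrow> B \<in> U"
  by (rule turing_ideal_le) (simp_all add: turing_le_iff_computable)

lemma le_join1: "A \<le>\<^sub>T join A B"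
proof -
  have "computable_in (join A B) (\<lambda>x. of_bool (2 * x \<in> join A B))" by (intro comp_intros)
  moreover have "2 * x \<in> join A B \<longleftrightarrow> x \<in> A" for x
    unfolding join_def by (auto simp: image_iff) presburger
  ultimately show ?thesis by (simp add: turing_le_iff_computable)
qed

lemma le_join2: "B \<le>\<^sub>T join A B"
proof -
  have "computable_in (join A B) (\<lambda>x. of_bool (2 * x + 1 \<in> join A B))" by (intro comp_intros)
  moreover have "2 * x + 1 \<in> join A B \<longleftrightarrow> x \<in> B" for x
    unfolding join_def by (auto simp: image_iff) presburger
  ultimately show ?thesis by (simp add: turing_le_iff_computable)
qed

lemma turing_ideal_join: "turing_ideal U \<Longrightarrow> A \<in> U \<Longrightarrow> B \<in> U \<Longrightarrow> join A B \<in> U"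
  unfolding turing_ideal_def by blast

lemma turing_ideal_Un:
  assumes "turing_ideal U" "A \<in> U" "B \<in> U"
  shows "A \<union> B \<in> U"
proof (rule turing_ideal_computable[OF assms(1) turing_ideal_join[OF assms]])
  have "computable_in (join A B) (\<lambda>x. of_bool (x \<in> A))"
    "computable_in (join A B) (\<lambda>x. of_bool (x \<in> B))"
    using le_join1 le_join2 unfolding turing_le_iff_computable by blast+
  then show "computable_in (join A B) (\<lambda>x. of_bool (x \<in> A \<union> B))"
    unfolding Un_iff by (rule computable_disj)
qed

text \<open>
  The columns \<open>{column_pos j i |i. True}\<close> partition the positive integers, and the \<open>j\<close>-th one has
  density \<open>1 / 2 ^ Suc j > 0\<close>. So coarse descriptions can be read off column by column.
\<close>

definition column_pos :: "nat \<Rightarrow> nat \<Rightarrow> nat" where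
  "column_pos j i = 2 ^ j * (2 * i + 1)"

lemma column_pos_eq_iff [simp]: "column_pos j i = column_pos j' i' \<longleftrightarrow> j = j' \<and> i = i'"
proof
  assume "column_pos j i = column_pos j' i'"
  then show "j = j' \<and> i = i'"
  proof (induction j arbitrary: j')
    case 0
    then show ?case by (cases j') (simp_all add: column_pos_def, presburger)
  next
    case (Suc j)
    show ?case
    proof (cases j')
      case 0
      with Suc.prems show ?thesis by (simp add: column_pos_def) presburger
    next
      case (Suc l)
      with Suc.prems have "column_pos j i = column_pos l i'" by (simp add: column_pos_def)
      from Suc.IH[OF this] Suc show ?thesis by simp
    qed
  qed
qed simp

lemma computable_column_pos [comp_intros]:
  assumes "computable_in A f" "computable_in A g"
  shows "computable_in A (\<lambda>x. column_pos (f x) (g x))"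
  unfolding column_pos_def by (intro assms comp_intros)

lemma column_pos_div_mod:
  "column_pos j i mod 2 ^ Suc j = 2 ^ j" "column_pos j i div 2 ^ Suc j = i"
proof -
  have eq: "column_pos j i = 2 ^ j + 2 ^ Suc j * i" by (simp add: column_pos_def algebra_simps)
  show "column_pos j i mod 2 ^ Suc j = 2 ^ j" "column_pos j i div 2 ^ Suc j = i"
    unfolding eq by simp_all
qed

lemma mem_column_iff:
  "x \<in> column_pos j ` A \<longleftrightarrow> x mod 2 ^ Suc j = 2 ^ j \<and> x div 2 ^ Suc j \<in> A"
proof
  assume "x mod 2 ^ Suc j = 2 ^ j \<and> x div 2 ^ Suc j \<in> A"
  moreover from this have "x = column_pos j (x div 2 ^ Suc j)"
    using div_mult_mod_eq[of x "2 ^ Suc j"] by (simp add: column_pos_def algebra_simps)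
  ultimately show "x \<in> column_pos j ` A" by blast
qed (auto simp only: column_pos_div_mod)

text \<open>There are at most \<open>m div 2 ^ n + 1\<close> multiples below \<open>m\<close>; the
  extra one is absorbed by a second summand \<open>m / 2 ^ n\<close>, which is at least 1.\<close>

lemma density_multiples:
  assumes "2 ^ n \<le> m"
  shows "density_upto m {x. 2 ^ n dvd x} \<le> 2 / 2 ^ n"
proof -
  have m: "0 < m" using assms by (meson less_le_trans zero_less_numeral zero_less_power)
  have "card ({x. 2 ^ n dvd x} \<inter> {0..<m}) \<le> card ((*) (2 ^ n) ` {..m div 2 ^ n})"
  proof (intro card_mono subsetI)
    fix x assume x: "x \<in> {x. 2 ^ n dvd x} \<inter> {0..<m}"
    then show "x \<in> (*) (2 ^ n) ` {..m div 2 ^ n}"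
      by (intro image_eqI[of _ _ "x div 2 ^ n"]) (auto intro: div_le_mono)
  qed simp
  also have "\<dots> \<le> m div 2 ^ n + 1" using card_image_le[of "{..m div 2 ^ n}"] by simp
  finally have "real (card ({x. 2 ^ n dvd x} \<inter> {0..<m})) \<le> real (m div 2 ^ n) + 1"
    by linarith
  also have "\<dots> \<le> m / 2 ^ n + m / 2 ^ n"
  proof -
    have "1 \<le> m / 2 ^ n" using assms by simp
    moreover have "real (m div 2 ^ n) \<le> m / 2 ^ n" using of_nat_div_le_of_nat[of m "2 ^ n", where ?'a = real] by simp
    ultimately show ?thesis by linarith
  qed
  finally show ?thesis using m by (simp add: density_upto_def field_simps)
qed

text \<open>Both necessary conditions draw on closedness through this lemma. It turns a sequence in
  \<open>U\<close>, however non-uniform, into a single member of \<open>U\<close> that describes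
  every term coarsely.\<close>

lemma closed_columns:
  assumes U: "turing_ideal U" and ne: "U \<noteq> {}" and cl: "closed (coarse_class ` U)"
    and A: "\<And>j. A j \<in> U"
  obtains B where "B \<in> U" "\<And>j. coarsely_similar {i. column_pos j i \<in> B} (A j)"
proof -
  define S where "S = (\<Union>j. column_pos j ` A j)"
  define T where "T n = (\<Union>j<n. column_pos j ` A j)" for n
  have T: "T n \<in> U" for n
  proof (induction n)
    case 0
    obtain C where "C \<in> U" using ne by blast
    moreover have "computable_in C (\<lambda>x. of_bool (x \<in> T 0))" by (simp add: T_def computable_const)
    ultimately show ?case using U turing_ideal_computable by blast
  next
    case (Suc n)
    have "computable_in (A n) (\<lambda>x. of_bool (x \<in> column_pos n ` A n))"
      unfolding mem_column_iff by (intro comp_intros)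
    then have "column_pos n ` A n \<in> U" using U A turing_ideal_computable by blast
    moreover have "T (Suc n) = column_pos n ` A n \<union> T n" by (simp add: T_def lessThan_Suc)
    ultimately show ?case using Suc turing_ideal_Un[OF U] by simp
  qed
  have ud: "upper_density (sym_diff (T n) S) \<le> 2 / 2 ^ n" for n
  proof (rule upper_density_leI)
    \<comment> \<open>The columns omitted from \<open>T n\<close> have index at least
      \<open>n\<close> and consist of multiples of \<open>2 ^ n\<close>.\<close>
    have "sym_diff (T n) S \<subseteq> {x. 2 ^ n dvd x}"
    proof
      fix x assume "x \<in> sym_diff (T n) S"
      then obtain j i where "x = column_pos j i" "n \<le> j" by (auto simp: S_def T_def not_less[symmetric])
      then show "x \<in> {x. 2 ^ n dvd x}" by (simp add: column_pos_def le_imp_power_dvd dvd_mult2)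
    qed
    then have "density_upto m (sym_diff (T n) S) \<le> density_upto m {x. 2 ^ n dvd x}" for m
      unfolding density_upto_def by (intro divide_right_mono of_nat_mono card_mono) auto
    with density_multiples[of n] have "density_upto m (sym_diff (T n) S) \<le> 2 / 2 ^ n"
      if "2 ^ n \<le> m" for m using that order_trans by blast
    with eventually_ge_at_top[of "2 ^ n"] show "\<forall>\<^sub>F m in sequentially. density_upto m (sym_diff (T n) S) \<le> 2 / 2 ^ n"
      by (rule eventually_mono)
  qed
  have "\<exists>C\<in>U. upper_density (sym_diff C S) < e" if "0 < e" for e
  proof -
    obtain n where "2 / e < 2 ^ n" using real_arch_pow[of 2 "2 / e"] by auto
    then have "2 / 2 ^ n < e" using that by (simp add: field_simps)
    with ud[of n] T[of n] show ?thesis by (intro bexI[of _ "T n"]) auto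
  qed
  then obtain B where B: "B \<in> U" "coarsely_similar B S"
    using cl unfolding closed_coarse_class_image_iff by blast
  show thesis
  proof
    fix j
    let ?D = "\<lambda>i. i \<in> sym_diff B S"
    have col: "sym_diff {i. column_pos j i \<in> B} (A j) = {i. ?D (column_pos j i)}"
      by (auto simp: S_def)
    \<comment> \<open>The first \<open>m\<close> positions of column \<open>j\<close> lie below
      \<open>2 ^ Suc j * m\<close>, so passing to the column magnifies the density of errors by at
      most the factor \<open>2 ^ Suc j\<close>.\<close>
    have bound: "density_upto m {i. ?D (column_pos j i)} \<le> 2 ^ Suc j * density_upto (2 ^ Suc j * m) (sym_diff B S)"
      for m
    proof -
      have "card ({i. ?D (column_pos j i)} \<inter> {0..<m}) = card (column_pos j ` ({i. ?D (column_pos j i)} \<inter> {0..<m}))"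
        by (rule card_image[symmetric]) (simp add: inj_on_def)
      also have "\<dots> \<le> card (sym_diff B S \<inter> {0..<2 ^ Suc j * m})"
      proof (rule card_mono)
        have "column_pos j i < 2 ^ Suc j * m" if "i < m" for i
        proof -
          have "2 * i + 1 < 2 * m" using that by simp
          then have "2 ^ j * (2 * i + 1) < 2 ^ j * (2 * m)" by (simp only: mult_less_cancel1) simp
          then show ?thesis by (simp add: column_pos_def)
        qed
        then show "column_pos j ` ({i. ?D (column_pos j i)} \<inter> {0..<m}) \<subseteq> sym_diff B S \<inter> {0..<2 ^ Suc j * m}"
          by auto
      qed simp
      finally have "real (card ({i. ?D (column_pos j i)} \<inter> {0..<m})) \<le> card (sym_diff B S \<inter> {0..<2 ^ Suc j * m})"
        by simp
      then show ?thesis by (simp add: density_upto_def divide_right_mono)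
    qed
    have "(\<lambda>m. density_upto (2 ^ Suc j * m) (sym_diff B S)) \<longlonglongrightarrow> 0"
      using LIMSEQ_subseq_LIMSEQ[of _ 0 "\<lambda>m. 2 ^ Suc j * m"] B(2)
      by (auto simp: coarsely_similar_def strict_mono_def o_def)
    from tendsto_mult_right_zero[OF this, of "2 ^ Suc j"]
    have "(\<lambda>m. density_upto m {i. ?D (column_pos j i)}) \<longlonglongrightarrow> 0"
      by (rule Lim_null_comparison[rotated]) (use bound density_upto_nonneg in \<open>simp add: always_eventually\<close>)
    then show "coarsely_similar {i. column_pos j i \<in> B} (A j)"
      by (simp only: coarsely_similar_def col)
  qed (rule B(1))
qed

section \<open>Jump-cofinality by majority votes in columns\<close>

lemma card_Int_upto: "card (A \<inter> {0..<n}) = card {i. i < n \<and> i \<in> A}" for n :: nat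
  by (rule arg_cong[where f = card]) auto

lemma card_compl_upto: "card {i. i < n \<and> \<not> P i} + card {i. i < n \<and> P i} = (n::nat)"
proof -
  have "card ({i. i < n \<and> \<not> P i} \<union> {i. i < n \<and> P i}) = card {i. i < n \<and> \<not> P i} + card {i. i < n \<and> P i}"
    by (rule card_Un_disjoint) auto
  moreover have "{i. i < n \<and> \<not> P i} \<union> {i. i < n \<and> P i} = {..<n}" by auto
  ultimately show ?thesis by simp
qed

lemma closed_imp_jump_cofinal:
  assumes U: "turing_ideal U" and ne: "U \<noteq> {}" and cl: "closed (coarse_class ` U)"
  shows "jump_cofinal U"
  unfolding jump_cofinal_def
proof
  fix X :: "nat set"
  obtain C where C: "C \<in> U" using ne by blast
  \<comment> \<open>Each column is to be full or empty, and both sets are computable.\<close>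
  have "{x. P} \<in> U" for P
    by (rule turing_ideal_computable[OF U C]) (simp add: computable_const)
  then obtain B where B: "B \<in> U" and sim: "\<And>j. coarsely_similar {i. column_pos j i \<in> B} {x. j \<in> X}"
    using closed_columns[OF U ne cl, of "\<lambda>j. {x. j \<in> X}"] by blast
  \<comment> \<open>The guess at stage \<open>s\<close> is the majority among the first
    \<open>s\<close> entries of column \<open>n\<close>. It is right as soon as the errors there
    have density below 1/2.\<close>
  define g :: "nat \<Rightarrow> nat \<Rightarrow> nat"
    where "g n s = of_bool (s < 2 * card {i. i < s \<and> column_pos n i \<in> B})" for n s
  have "X \<le>\<^sub>T jump B"
  proof (rule le_jump_if_limit_computable)
    show "computable_in B (\<lambda>w. g (pfst w) (psnd w))" unfolding g_def by (intro comp_intros)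
    fix n
    have "upper_density (sym_diff {i. column_pos n i \<in> B} {x. n \<in> X}) < 1 / 2"
      using sim[of n] by (simp add: coarsely_similar_iff_upper_density)
    from eventually_card_less[OF this] show "\<forall>\<^sub>F s in sequentially. g n s = of_bool (n \<in> X)"
    proof eventually_elim
      case (elim s)
      show ?case
      proof (cases "n \<in> X")
        case True
        with elim have "2 * card {i. i < s \<and> column_pos n i \<notin> B} < s"
          by (simp add: card_Int_upto)
        with card_compl_upto[of s "\<lambda>i. column_pos n i \<in> B"] show ?thesis
          using True by (simp add: g_def)
      next
        case False
        with elim have "2 * card {i. i < s \<and> column_pos n i \<in> B} < s"
          by (simp add: card_Int_upto)
        then show ?thesis using False by (simp add: g_def)
      qed
    qed
  qed
  then show "\<exists>C\<in>U. X \<le>\<^sub>T jump C" using B by blast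
qed

section \<open>Dyadic blocks (the integer part of the binary logarithm of a positive number) and
  countable bounds\<close>

definition dyadic_block :: "nat \<Rightarrow> nat" where
  "dyadic_block x = (LEAST k. x < 2 ^ Suc k)"

lemma dyadic_block_less: "x < 2 ^ Suc (dyadic_block x)"
proof -
  have "x < 2 ^ Suc x" using less_exp[of "Suc x"] by linarith
  then show ?thesis unfolding dyadic_block_def by (rule LeastI)
qed

lemma dyadic_block_eq:
  assumes "2 ^ k \<le> x" "x < 2 ^ Suc k"
  shows "dyadic_block x = k"
  unfolding dyadic_block_def
proof (rule Least_equality)
  fix l assume "x < 2 ^ Suc l"
  with assms(1) have "(2::nat) ^ k < 2 ^ Suc l" by linarith
  then show "k \<le> l" by (simp add: less_Suc_eq_le del: power_Suc)
qed (rule assms(2))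

lemma computable_dyadic_block [comp_intros]:
  assumes "computable_in A f"
  shows "computable_in A (\<lambda>x. dyadic_block (f x))"
proof -
  have "computable_in A (\<lambda>x. LEAST k. x < 2 ^ Suc k)"
    using dyadic_block_less by (intro computable_Least comp_intros) blast
  from computable_compose[OF this assms] show ?thesis by (simp add: dyadic_block_def)
qed

lemma computable_finite:
  "finite F \<Longrightarrow> computable_in A (\<lambda>x. of_bool (x \<in> F))"
  by (induction F rule: finite_induct) (simp_all only: empty_iff insert_iff; intro comp_intros)+

text \<open>The finitely many values below \<open>K\<close> are hard-wired into the program.\<close>

lemma turing_le_finite_change:
  assumes "computable_in A (\<lambda>x. of_bool (P x))" "\<And>x. K \<le> x \<Longrightarrow> x \<in> B \<longleftrightarrow> P x"
  shows "B \<le>\<^sub>T A"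
proof -
  have "computable_in A (\<lambda>x. of_bool (x \<in> B \<inter> {..<K} \<or> K \<le> x \<and> P x))"
    by (intro assms(1) comp_intros computable_finite) simp
  moreover have "x \<in> B \<inter> {..<K} \<or> K \<le> x \<and> P x \<longleftrightarrow> x \<in> B" for x
    using assms(2)[of x] by (cases "K \<le> x") auto
  ultimately show ?thesis unfolding turing_le_iff_computable by (simp only:)
qed

text \<open>
  A block \<open>{2 ^ k..<2 ^ Suc k}\<close> makes up half of \<open>{0..<2 ^ Suc k}\<close>, so for large \<open>k\<close> a majority
  vote in the block decides \<open>k \<in> A\<close> correctly.
\<close>

lemma turing_le_coarse_description:
  assumes "coarsely_similar D {y. dyadic_block y \<in> A}"
  shows "A \<le>\<^sub>T D"
proof -
  let ?E = "sym_diff D {y. dyadic_block y \<in> A}"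
  \<comment> \<open>Fewer than \<open>2 ^ Suc k / 4\<close> errors below \<open>2 ^ Suc k\<close>
    are less than half of the \<open>2 ^ k\<close> entries of the block.\<close>
  have "upper_density ?E < 1 / 4"
    using assms by (simp add: coarsely_similar_iff_upper_density)
  from eventually_card_less[OF this]
  obtain N where N: "\<And>n. N \<le> n \<Longrightarrow> card (?E \<inter> {0..<n}) < 1 / 4 * n"
    unfolding eventually_sequentially by blast
  show ?thesis
  proof (rule turing_le_finite_change)
    show "computable_in D (\<lambda>k. of_bool (2 ^ k < 2 * card {i. i < 2 ^ k \<and> 2 ^ k + i \<in> D}))"
      by (intro comp_intros)
    fix k assume "N \<le> k"
    then have "N \<le> 2 ^ Suc k"
      by (meson le_trans less_exp less_imp_le_nat power_increasing Suc_n_not_le_n nat_le_linear one_le_numeral)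
    from N[OF this] have "real (2 * card (?E \<inter> {0..<2 ^ Suc k})) < real (2 ^ k)" by simp
    then have E: "2 * card (?E \<inter> {0..<2 ^ Suc k}) < 2 ^ k" by (simp only: of_nat_less_iff)
    have block: "dyadic_block (2 ^ k + i) = k" if "i < 2 ^ k" for i
      using that by (intro dyadic_block_eq) simp_all
    have bound: "card {i. i < 2 ^ k \<and> (2 ^ k + i \<in> D \<longleftrightarrow> k \<notin> A)} \<le> card (?E \<inter> {0..<2 ^ Suc k})"
    proof (rule card_inj_on_le[of "(+) (2 ^ k)"])
      show "(+) (2 ^ k) ` {i. i < 2 ^ k \<and> (2 ^ k + i \<in> D \<longleftrightarrow> k \<notin> A)} \<subseteq> ?E \<inter> {0..<2 ^ Suc k}"
        using block by auto
    qed simp_all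
    show "k \<in> A \<longleftrightarrow> 2 ^ k < 2 * card {i. i < 2 ^ k \<and> 2 ^ k + i \<in> D}"
      using E bound card_compl_upto[of "2 ^ k" "\<lambda>i. 2 ^ k + i \<in> D"] by (cases "k \<in> A") auto
  qed
qed

text \<open>Spreading \<open>f j\<close> over dyadic blocks makes it survive coarse errors. The
  finitely many wrong votes are corrected for each \<open>j\<close> separately, as an upper bound
  asks for one reduction per set.\<close>

lemma closed_imp_countably_bounded:
  assumes U: "turing_ideal U" and ne: "U \<noteq> {}" and cl: "closed (coarse_class ` U)"
    and V: "V \<subseteq> U" "countable V"
  shows "\<exists>B\<in>U. \<forall>A\<in>V. A \<le>\<^sub>T B"
proof (cases "V = {}")
  case False
  define f where "f = from_nat_into V"
  have f: "range f = V" using range_from_nat_into[OF False V(2)] by (simp add: f_def)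
  have "{y. dyadic_block y \<in> f j} \<in> U" for j
  proof (rule turing_ideal_computable[OF U])
    show "f j \<in> U" using f V(1) by blast
    show "computable_in (f j) (\<lambda>x. of_bool (x \<in> {y. dyadic_block y \<in> f j}))"
      unfolding mem_Collect_eq by (intro comp_intros)
  qed
  then obtain B where B: "B \<in> U"
    and sim: "\<And>j. coarsely_similar {i. column_pos j i \<in> B} {y. dyadic_block y \<in> f j}"
    using closed_columns[OF U ne cl, of "\<lambda>j. {y. dyadic_block y \<in> f j}"] by blast
  have "f j \<le>\<^sub>T B" for j
  proof (rule turing_le_trans[OF turing_le_coarse_description[OF sim]])
    show "{i. column_pos j i \<in> B} \<le>\<^sub>T B"
      unfolding turing_le_iff_computable mem_Collect_eq by (intro comp_intros)
  qed
  then show ?thesis using B f by blast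
qed (use ne in blast)

section \<open>Jump-cofinal ideals with countable bounds are closed\<close>

lemma dyadic_block_le:
  assumes "0 < x"
  shows "2 ^ dyadic_block x \<le> x"
proof (cases "dyadic_block x")
  case (Suc k)
  then have "\<not> x < 2 ^ Suc k" using not_less_Least[of k "\<lambda>k. x < 2 ^ Suc k"]
    by (simp only: dyadic_block_def) simp
  then show ?thesis using Suc by simp
qed (use assms in simp)

text \<open>The block bounds add up to a geometric sum of at most \<open>4 * 2 ^ k\<close> below
  \<open>2 ^ k\<close>. Rounding \<open>n\<close> up to a power of 2 doubles this to at most
  \<open>8 * n\<close>, and the part below \<open>2 ^ K\<close> costs another \<open>n\<close>,
  which makes 9.\<close>

lemma upper_density_le_if_dyadic:
  assumes block: "\<And>k. K \<le> k \<Longrightarrow> a * card (Z \<inter> {2 ^ k..<2 ^ Suc k}) \<le> 4 * 2 ^ k"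
    and a: "0 < a"
  shows "upper_density Z \<le> 9 / real a"
proof (rule upper_density_leI)
  have prefix: "a * card (Z \<inter> {0..<2 ^ k}) \<le> a * 2 ^ K + 4 * 2 ^ k" if "K \<le> k" for k
    using that
  proof (induction k rule: dec_induct)
    case base
    have "card (Z \<inter> {0..<2 ^ K}) \<le> card {0..<2 ^ K :: nat}" by (intro card_mono) auto
    then show ?case by (simp add: trans_le_add1)
  next
    case (step k)
    have "Z \<inter> {0..<2 ^ Suc k} = Z \<inter> {0..<2 ^ k} \<union> Z \<inter> {2 ^ k..<2 ^ Suc k}" by auto
    then have "card (Z \<inter> {0..<2 ^ Suc k}) \<le> card (Z \<inter> {0..<2 ^ k}) + card (Z \<inter> {2 ^ k..<2 ^ Suc k})"
      by (simp only: card_Un_le)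
    then have "a * card (Z \<inter> {0..<2 ^ Suc k})
        \<le> a * card (Z \<inter> {0..<2 ^ k}) + a * card (Z \<inter> {2 ^ k..<2 ^ Suc k})"
      by (simp only: distrib_left[symmetric] mult_le_mono2)
    also have "\<dots> \<le> (a * 2 ^ K + 4 * 2 ^ k) + 4 * 2 ^ k"
      using step by (intro add_mono block) auto
    finally show ?case by simp
  qed
  have "density_upto n Z \<le> 9 / real a" if n: "a * 2 ^ K \<le> n" "0 < n" for n
  proof -
    define k where "k = dyadic_block n"
    have k: "2 ^ k \<le> n" "n < 2 ^ Suc k"
      unfolding k_def using dyadic_block_le dyadic_block_less n by auto
    have "2 ^ K \<le> a * 2 ^ K" using a by simp
    then have "2 ^ K < (2::nat) ^ Suc k" using n(1) k(2) by linarith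
    then have "K \<le> k" by (simp add: less_Suc_eq_le del: power_Suc)
    have "card (Z \<inter> {0..<n}) \<le> card (Z \<inter> {0..<2 ^ Suc k})" using k(2) by (intro card_mono) auto
    then have "a * card (Z \<inter> {0..<n}) \<le> a * card (Z \<inter> {0..<2 ^ Suc k})" by simp
    also have "\<dots> \<le> a * 2 ^ K + 4 * 2 ^ Suc k" using prefix[of "Suc k"] \<open>K \<le> k\<close> by simp
    also have "\<dots> \<le> 9 * n" using n(1) k(1) by simp
    finally have "real (a * card (Z \<inter> {0..<n})) \<le> real (9 * n)" by (simp only: of_nat_le_iff)
    then show ?thesis using n(2) a by (simp add: density_upto_def field_simps)
  qed
  then show "\<forall>\<^sub>F n in sequentially. density_upto n Z \<le> 9 / real a"
    unfolding eventually_sequentially by (intro exI[of _ "Suc (a * 2 ^ K)"]) auto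
qed

text \<open>An initial segment of \<open>A\<close> is overwritten by that of \<open>C\<close>. The
  bound then holds for every \<open>m\<close> and not just eventually, so that good stages exist for
  every block later on.\<close>

lemma finite_change_density_bound:
  assumes U: "turing_ideal U" and A: "A \<in> U" "upper_density (sym_diff A C) < 1 / 2 ^ j"
  obtains B where "B \<in> U" "\<And>m. 2 ^ j * card (sym_diff B C \<inter> {0..<m}) \<le> m"
proof -
  obtain N where N: "\<And>n. N \<le> n \<Longrightarrow> card (sym_diff A C \<inter> {0..<n}) < 1 / 2 ^ j * real n"
    using eventually_card_less[OF A(2)] unfolding eventually_sequentially by blast
  define B where "B = C \<inter> {..<N} \<union> (A - {..<N})"
  show thesis
  proof
    have "B \<le>\<^sub>T A"
      by (rule turing_le_finite_change[of A "\<lambda>x. x \<in> A" N]) (auto simp: B_def intro: comp_intros)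
    with U A(1) show "B \<in> U" by (rule turing_ideal_le)
    fix m
    show "2 ^ j * card (sym_diff B C \<inter> {0..<m}) \<le> m"
    proof (cases "m \<le> N")
      case True
      then have "sym_diff B C \<inter> {0..<m} = {}" by (auto simp: B_def)
      then show ?thesis by simp
    next
      case False
      have "card (sym_diff B C \<inter> {0..<m}) \<le> card (sym_diff A C \<inter> {0..<m})"
        by (intro card_mono) (auto simp: B_def)
      then have "real (card (sym_diff B C \<inter> {0..<m})) \<le> 1 / 2 ^ j * real m"
        using N[of m] False by linarith
      then have "real (2 ^ j * card (sym_diff B C \<inter> {0..<m})) \<le> real m"
        by (simp add: field_simps)
      then show ?thesis by (simp only: of_nat_le_iff)
    qed
  qed
qed

lemma closed_if_jump_cofinal_and_bounded:
  assumes U: "turing_ideal U"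
    and jc: "jump_cofinal U"
    and bounded: "\<And>V. V \<subseteq> U \<Longrightarrow> countable V \<Longrightarrow> \<exists>B\<in>U. \<forall>A\<in>V. A \<le>\<^sub>T B"
  shows "closed (coarse_class ` U)"
  unfolding closed_coarse_class_image_iff
proof (intro allI impI)
  fix C :: "nat set"
  assume C: "\<forall>e>0. \<exists>A\<in>U. upper_density (sym_diff A C) < e"
  have "\<exists>B. B \<in> U \<and> (\<forall>m. 2 ^ j * card (sym_diff B C \<inter> {0..<m}) \<le> m)" for j
  proof -
    have "0 < 1 / (2::real) ^ j" by simp
    with C obtain A where "A \<in> U" "upper_density (sym_diff A C) < 1 / 2 ^ j" by blast
    from finite_change_density_bound[OF U this] show ?thesis by metis
  qed
  then obtain B where B: "\<And>j. B j \<in> U"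
    and BC: "\<And>j m. 2 ^ j * card (sym_diff (B j) C \<inter> {0..<m}) \<le> m"
    by metis
  have "range B \<subseteq> U" using B by blast
  from bounded[OF this] obtain E where E: "E \<in> U" "\<And>j. B j \<le>\<^sub>T E" by auto
  then obtain p where p: "\<And>j x. eval E (p j) x = Some (of_bool (x \<in> B j))"
    unfolding turing_le_def by metis
  \<comment> \<open>The sequence of indices is coded as the graph of a function, since
    jump-cofinality speaks of sets.\<close>
  define X where "X = range (\<lambda>j. prod_encode (j, goedel (p j)))"
  have X: "prod_encode (j, i) \<in> X \<longleftrightarrow> i = goedel (p j)" for i j
    by (auto simp: X_def)
  obtain D where D: "D \<in> U" "X \<le>\<^sub>T jump D" using jc unfolding jump_cofinal_def by blast
  from D(2) obtain g where gD: "computable_in D (\<lambda>w. g (pfst w) (psnd w))"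
    and g: "\<And>n. \<forall>\<^sub>F s in sequentially. g n s = of_bool (n \<in> X)"
    by (rule limit_computable_if_le_jump) blast
  \<comment> \<open>At stage \<open>s\<close> the index of \<open>B j\<close> is guessed to be \<open>idx j s\<close>. A stage is good for \<open>k\<close> if its guesses
    for \<open>j \<le> k\<close> converge on \<open>{0..<2 ^ Suc k}\<close> within \<open>s\<close> steps and are as close to each other as the
    true sets are. The guess for \<open>B k\<close> used there may still be wrong, but it is close to every
    \<open>B j\<close> whose guess has settled.\<close>
  define idx where "idx j s = (LEAST i. g (prod_encode (j, i)) s = 1 \<or> s \<le> i)" for j s
  define v where "v j s y = bounded_eval (\<lambda>y. of_bool (y \<in> E)) (idx j s) y s" for j s y
  define good where "good k s \<longleftrightarrow> k \<le> s \<and> (\<forall>j<Suc k. (\<forall>y<2 ^ Suc k. v j s y \<noteq> 0) \<and>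
      2 ^ j * card {y. y < 2 ^ Suc k \<and> \<not> (v j s y = 2 \<longleftrightarrow> v k s y = 2)} \<le> 2 * 2 ^ Suc k)" for k s
  define st where "st k = (LEAST s. good k s)" for k
  \<comment> \<open>The value 2 is \<open>Suc 1\<close>: the computation has halted and answers
    yes.\<close>
  define F where "F = {x. v (dyadic_block x) (st (dyadic_block x)) x = 2}"

  have idx: "\<forall>\<^sub>F s in sequentially. idx j s = goedel (p j)" for j
  proof -
    \<comment> \<open>Only the candidates up to the true index matter: once all of them are judged
      correctly and \<open>s\<close> exceeds that index, the search stops exactly there.\<close>
    have "\<forall>\<^sub>F s in sequentially. \<forall>i\<in>{..goedel (p j)}.
        g (prod_encode (j, i)) s = of_bool (prod_encode (j, i) \<in> X)"
      by (intro eventually_ball_finite ballI g) simp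
    with eventually_gt_at_top[of "goedel (p j)"] show ?thesis
    proof eventually_elim
      case (elim s)
      show ?case unfolding idx_def
      proof (rule Least_equality)
        fix i assume i: "g (prod_encode (j, i)) s = 1 \<or> s \<le> i"
        show "goedel (p j) \<le> i"
        proof (rule ccontr)
          assume "\<not> goedel (p j) \<le> i"
          with elim i show False by (auto simp: X)
        qed
      qed (use elim in \<open>simp add: X\<close>)
    qed
  qed
  have v: "\<forall>\<^sub>F s in sequentially. v j s y = Suc (of_bool (y \<in> B j))" for j y
    using idx[of j] eventually_bounded_eval[OF p[of j y]]
    by eventually_elim (simp add: v_def)
  \<comment> \<open>With the right index, a computation that has halted within the time bound is
    already correct, however early the stage.\<close>
  have v_correct: "v j s y = Suc (of_bool (y \<in> B j))"
    if "v j s y \<noteq> 0" "idx j s = goedel (p j)" for j s y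
  proof -
    obtain u where u: "v j s y = Suc u" using \<open>v j s y \<noteq> 0\<close> not0_implies_Suc by blast
    then have "eval E (p j) y = Some u"
      using that(2) unfolding eval_iff_bounded_eval v_def by metis
    then show ?thesis using u p by simp
  qed
  \<comment> \<open>Going through \<open>C\<close> costs \<open>m / 2 ^ j + m / 2 ^ k\<close>, at
    most \<open>2 * m / 2 ^ j\<close> for \<open>j \<le> k\<close>; hence the factor 2 in
    \<open>good\<close>.\<close>
  have BB: "2 ^ j * card {y. y < m \<and> \<not> (y \<in> B j \<longleftrightarrow> y \<in> B k)} \<le> 2 * m" if "j \<le> k" for j k m
  proof -
    have "card {y. y < m \<and> \<not> (y \<in> B j \<longleftrightarrow> y \<in> B k)}
        \<le> card (sym_diff (B j) C \<inter> {0..<m} \<union> sym_diff (B k) C \<inter> {0..<m})"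
      by (intro card_mono) auto
    also have "\<dots> \<le> card (sym_diff (B j) C \<inter> {0..<m}) + card (sym_diff (B k) C \<inter> {0..<m})"
      by (rule card_Un_le)
    finally have "2 ^ j * card {y. y < m \<and> \<not> (y \<in> B j \<longleftrightarrow> y \<in> B k)}
        \<le> 2 ^ j * card (sym_diff (B j) C \<inter> {0..<m}) + 2 ^ j * card (sym_diff (B k) C \<inter> {0..<m})"
      by (simp only: distrib_left[symmetric] mult_le_mono2)
    also have "2 ^ j * card (sym_diff (B k) C \<inter> {0..<m}) \<le> 2 ^ k * card (sym_diff (B k) C \<inter> {0..<m})"
      using that by (intro mult_right_mono power_increasing) auto
    finally show ?thesis using BC[of j m] BC[of k m] by linarith
  qed
  have "\<exists>s. good k s" for k
  proof -
    \<comment> \<open>Only finitely many guesses concern \<open>k\<close>, so at all late stages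
      they agree with the true sets, which pass the closeness test by \<open>BB\<close>.\<close>
    have "\<forall>\<^sub>F s in sequentially. \<forall>j\<in>{..k}. \<forall>y\<in>{..<2 ^ Suc k}. v j s y = Suc (of_bool (y \<in> B j))"
      by (intro eventually_ball_finite ballI v) simp_all
    with eventually_ge_at_top[of k] have "\<forall>\<^sub>F s in sequentially. good k s"
    proof eventually_elim
      case (elim s)
      have mem: "v i s y = 2 \<longleftrightarrow> y \<in> B i" if "i \<le> k" "y < 2 ^ Suc k" for i y
        using elim that by (cases "y \<in> B i") (simp_all del: power_Suc)
      have "2 ^ j * card {y. y < 2 ^ Suc k \<and> \<not> (v j s y = 2 \<longleftrightarrow> v k s y = 2)} \<le> 2 * 2 ^ Suc k"
        if "j < Suc k" for j
      proof -
        have "{y. y < 2 ^ Suc k \<and> \<not> (v j s y = 2 \<longleftrightarrow> v k s y = 2)}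
            = {y. y < 2 ^ Suc k \<and> \<not> (y \<in> B j \<longleftrightarrow> y \<in> B k)}"
          using mem that by (intro Collect_cong conj_cong refl) simp
        then show ?thesis using BB[of j k "2 ^ Suc k"] that by simp
      qed
      moreover have "v j s y \<noteq> 0" if "j < Suc k" "y < 2 ^ Suc k" for j y
        using elim that by simp
      ultimately show ?case using elim unfolding good_def by blast
    qed
    then show ?thesis unfolding eventually_sequentially by blast
  qed
  then have st: "good k (st k)" for k unfolding st_def by (rule LeastI_ex)

  \<comment> \<open>The bound is made up of 9 for the distance from \<open>F\<close> to
    \<open>B j\<close> and 1 for that from \<open>B j\<close> to \<open>C\<close>.\<close>
  have "upper_density (sym_diff F C) \<le> 10 / 2 ^ j" for j
  proof -
    obtain K where K: "\<And>s. K \<le> s \<Longrightarrow> idx j s = goedel (p j)"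
      using idx[of j] unfolding eventually_sequentially by blast
    \<comment> \<open>As \<open>st k\<close> is at least \<open>k\<close>, the condition
      \<open>K \<le> k\<close> settles the index of \<open>B j\<close>, while
      \<open>j \<le> k\<close> puts \<open>j\<close> among the guesses compared at that
      stage.\<close>
    have block: "2 ^ j * card (sym_diff F (B j) \<inter> {2 ^ k..<2 ^ Suc k}) \<le> 4 * 2 ^ k"
      if k: "max K j \<le> k" for k
    proof -
      from st[of k] k have s: "k \<le> st k" and conv: "\<And>y. y < 2 ^ Suc k \<Longrightarrow> v j (st k) y \<noteq> 0"
        and close: "2 ^ j * card {y. y < 2 ^ Suc k \<and> \<not> (v j (st k) y = 2 \<longleftrightarrow> v k (st k) y = 2)}
            \<le> 2 * 2 ^ Suc k"
        unfolding good_def by auto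
      have "idx j (st k) = goedel (p j)" using K s k by simp
      then have vj: "v j (st k) y = 2 \<longleftrightarrow> y \<in> B j" if "y < 2 ^ Suc k" for y
        using v_correct[OF conv[OF that]] by simp
      have "sym_diff F (B j) \<inter> {2 ^ k..<2 ^ Suc k}
          \<subseteq> {y. y < 2 ^ Suc k \<and> \<not> (v j (st k) y = 2 \<longleftrightarrow> v k (st k) y = 2)}"
        using vj dyadic_block_eq[of k] by (auto simp: F_def)
      then have "card (sym_diff F (B j) \<inter> {2 ^ k..<2 ^ Suc k})
          \<le> card {y. y < 2 ^ Suc k \<and> \<not> (v j (st k) y = 2 \<longleftrightarrow> v k (st k) y = 2)}"
        by (intro card_mono) simp_all
      then have "2 ^ j * card (sym_diff F (B j) \<inter> {2 ^ k..<2 ^ Suc k})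
          \<le> 2 ^ j * card {y. y < 2 ^ Suc k \<and> \<not> (v j (st k) y = 2 \<longleftrightarrow> v k (st k) y = 2)}"
        by (rule mult_le_mono2)
      from order_trans[OF this close] show ?thesis by simp
    qed
    have "upper_density (sym_diff F (B j)) \<le> 9 / real (2 ^ j)"
      by (rule upper_density_le_if_dyadic[of "max K j"]) (use block in auto)
    moreover have "upper_density (sym_diff (B j) C) \<le> 1 / 2 ^ j"
    proof (rule upper_density_leI)
      show "\<forall>\<^sub>F n in sequentially. density_upto n (sym_diff (B j) C) \<le> 1 / 2 ^ j"
        using eventually_gt_at_top[of 0]
      proof eventually_elim
        case (elim n)
        have "real (2 ^ j * card (sym_diff (B j) C \<inter> {0..<n})) \<le> real n"
          using BC[of j n] by (simp only: of_nat_le_iff)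
        then show ?case using elim by (simp add: density_upto_def field_simps)
      qed
    qed
    ultimately show ?thesis using upper_density_triangle[of F C "B j"] by simp
  qed
  moreover have "(\<lambda>j. 10 / 2 ^ j :: real) \<longlonglongrightarrow> 0"
    using LIMSEQ_divide_realpow_zero[of 2 10] by simp
  ultimately have "upper_density (sym_diff F C) \<le> 0"
    by (intro LIMSEQ_le_const) auto
  then have "coarsely_similar F C"
    using upper_density_nonneg[of "sym_diff F C"] by (simp add: coarsely_similar_iff_upper_density)
  moreover have "F \<in> U"
  proof (rule turing_ideal_computable[OF U turing_ideal_join[OF U E(1) D(1)]])
    let ?G = "join E D"
    have gG: "computable_in ?G (\<lambda>w. g (pfst w) (psnd w))"
      using gD le_join2 by (rule computable_in_mono)
    have EG: "computable_in ?G (\<lambda>w. of_bool (psnd w \<in> E))"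
      using computable_in_mono[OF computable_oracle[OF computable_psnd[OF computable_id]] le_join1] .
    \<comment> \<open>The cutoff \<open>s \<le> i\<close> in \<open>idx\<close> makes this search
      total: it ends at \<open>i = s\<close> at the latest.\<close>
    have idxG: "computable_in ?G (\<lambda>w. idx (pfst w) (psnd w))"
      unfolding idx_def by (intro computable_Least comp_intros computable_compose2[OF gG]) auto
    have vG: "computable_in ?G (\<lambda>x. v (a x) (b x) (c x))"
      if "computable_in ?G a" "computable_in ?G b" "computable_in ?G c" for a b c
      unfolding v_def
      by (rule computable_bounded_eval[where q = "\<lambda>_ y. of_bool (y \<in> E)" and c = "\<lambda>x. 0"])
        (intro EG comp_intros that computable_compose2[OF idxG])+
    have "computable_in ?G (\<lambda>w. of_bool (good (pfst w) (psnd w)))"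
      unfolding good_def by (intro comp_intros vG)
    then have stG: "computable_in ?G st"
      unfolding st_def using \<open>\<And>k. \<exists>s. good k s\<close> by (rule computable_Least)
    show "computable_in ?G (\<lambda>x. of_bool (x \<in> F))"
      unfolding F_def mem_Collect_eq
      by (intro comp_intros vG computable_compose[OF stG])
  qed
  ultimately show "\<exists>A\<in>U. coarsely_similar A C" by blast
qed

theorem theorem3p14:
  fixes U :: "nat set set"
  assumes "turing_ideal U"
    and "coarse_class ` U \<noteq> {}"
  shows "closed (coarse_class ` U) \<longleftrightarrow>
    jump_cofinal U \<and>
    (\<forall>V. V \<subseteq> U \<and> countable V \<longrightarrow> (\<exists>B\<in>U. \<forall>A\<in>V. A \<le>\<^sub>T B))"
proof -
  have "U \<noteq> {}" using assms(2) by blast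
  then show ?thesis
    using closed_imp_jump_cofinal[OF assms(1)] closed_imp_countably_bounded[OF assms(1)]
      closed_if_jump_cofinal_and_bounded[OF assms(1)]
    by (intro iffI conjI allI impI) blast+
qed

end
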